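(* Suppose that for every fixed $l\in\mathbb N$ the number of isomorphism classes of nonabelian finite simple groups satisfying a nonsingular mixed identity of length $l$ is finite. Then every mixed identity of an infinite simple locally finite group is singular.
   Context: Let $\mathbf F_r$ be the free group on $x_1,\dots,x_r$ ($r\ge1$ arbitrary). Every $w\in G*\mathbf F_r$ has a reduced form $w=c_0x_{i(1)}^{\varepsilon(1)}c_1\cdots c_{l-1}x_{i(l)}^{\varepsilon(l)}c_l$ with $c_j\in G$, $\varepsilon(j)\in\{\pm1\}$, where $c_j\ne 1$ whenever $i(j)=i(j+1)$ and $\varepsilon(j)=-\varepsilon(j+1)$ ($1\le j\le l-1$); its length is $l$. $w$ is a mixed identity for $G$ if $w\neq1$ and $w(g_1,\dots,g_r)=1$ for all $(g_1,\dots,g_r)\in G^r$. The content of $w$ is $x_{i(1)}^{\varepsilon(1)}\cdots x_{i(l)}^{\varepsilon(l)}\in\mathbf F_r$; $w$ is singular if its content is trivial and nonsingular otherwise. *)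

theory Defs
  imports "HOL-Algebra.SimpleGroups" "HOL-Algebra.Generated_Groups"
begin

inductive_set word_cong :: "'x set \<Rightarrow> ('x list \<times> 'x list) set \<Rightarrow> ('x list \<times> 'x list) set"
  for A E where
  base: "(l, r) \<in> E \<Longrightarrow> l \<in> lists A \<Longrightarrow> r \<in> lists A \<Longrightarrow> u \<in> lists A \<Longrightarrow> v \<in> lists A
    \<Longrightarrow> (u @ l @ v, u @ r @ v) \<in> word_cong A E"
| refl: "u \<in> lists A \<Longrightarrow> (u, u) \<in> word_cong A E"
| sym: "(u, v) \<in> word_cong A E \<Longrightarrow> (v, u) \<in> word_cong A E"
| trans: "(u, v) \<in> word_cong A E \<Longrightarrow> (v, w) \<in> word_cong A E \<Longrightarrow> (u, w) \<in> word_cong A E"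

text \<open>The monoid with generators \<open>A\<close> and relations \<open>l = r\<close> for \<open>(l, r) \<in> E\<close>: the free monoid
  \<open>lists A\<close> modulo the congruence generated by \<open>E\<close>.\<close>

definition presented :: "'x set \<Rightarrow> ('x list \<times> 'x list) set \<Rightarrow> 'x list set monoid" where
  "presented A E = \<lparr>carrier = lists A // word_cong A E,
     monoid.mult = (\<lambda>P Q. \<Union>u\<in>P. \<Union>v\<in>Q. word_cong A E `` {u @ v}),
     one = word_cong A E `` {[]}\<rparr>"

primrec word_val :: "('b, 'm) monoid_scheme \<Rightarrow> ('x \<Rightarrow> 'b) \<Rightarrow> 'x list \<Rightarrow> 'b" where
  "word_val K f [] = \<one>\<^bsub>K\<^esub>"
| "word_val K f (x # xs) = f x \<otimes>\<^bsub>K\<^esub> word_val K f xs"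

text \<open>The map on congruence classes induced by a valuation of the letters. It is meaningful when
  the valuation respects the relations; then all words of a class have the same value.\<close>

definition lift :: "('b, 'm) monoid_scheme \<Rightarrow> ('x \<Rightarrow> 'b) \<Rightarrow> 'x list set \<Rightarrow> 'b" where
  "lift K f P = the_elem (word_val K f ` P)"

lemma word_cong_lists:
  assumes "(u, v) \<in> word_cong A E" shows "u \<in> lists A \<and> v \<in> lists A"
  using assms by induction auto

lemma equiv_word_cong: "equiv (lists A) (word_cong A E)"
proof (rule equivI)
  show "word_cong A E \<subseteq> lists A \<times> lists A"
    by (auto dest: word_cong_lists)
  show "refl_on (lists A) (word_cong A E)"
    by (rule refl_onI) (auto intro: word_cong.refl)
  show "sym (word_cong A E)" by (rule symI) (rule word_cong.sym)
  show "trans (word_cong A E)" by (rule transI) (rule word_cong.trans)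
qed

lemma word_cong_context:
  assumes "(u, v) \<in> word_cong A E" "p \<in> lists A" "q \<in> lists A"
  shows "(p @ u @ q, p @ v @ q) \<in> word_cong A E"
  using assms
proof (induction)
  case (base l r u v)
  then have "((p @ u) @ l @ (v @ q), (p @ u) @ r @ (v @ q)) \<in> word_cong A E"
    by (intro word_cong.base) auto
  then show ?case by simp
next
  case (refl u)
  then show ?case by (intro word_cong.refl) auto
next
  case (sym u v)
  then show ?case using word_cong.sym by blast
next
  case (trans u v w)
  then show ?case using word_cong.trans[of "p @ u @ q" "p @ v @ q"] by blast
qed

lemma word_cong_append:
  assumes "(u, u') \<in> word_cong A E" "(v, v') \<in> word_cong A E"
  shows "(u @ v, u' @ v') \<in> word_cong A E"
proof -
  have "([] @ u @ v, [] @ u' @ v) \<in> word_cong A E"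
    using assms word_cong_lists[OF assms(2)] by (intro word_cong_context) auto
  moreover have "(u' @ v @ [], u' @ v' @ []) \<in> word_cong A E"
    using assms word_cong_lists[OF assms(1)] by (intro word_cong_context) auto
  ultimately show ?thesis using word_cong.trans[of "u @ v" "u' @ v"] by simp
qed

lemma presented_mult:
  assumes "u \<in> lists A" "v \<in> lists A"
  shows "word_cong A E `` {u} \<otimes>\<^bsub>presented A E\<^esub> word_cong A E `` {v}
    = word_cong A E `` {u @ v}" (is "?L = ?R")
proof -
  have *: "word_cong A E `` {u' @ v'} = ?R"
    if "(u, u') \<in> word_cong A E" "(v, v') \<in> word_cong A E" for u' v'
    by (rule equiv_class_eq[OF equiv_word_cong])
      (rule word_cong.sym[OF word_cong_append[OF that]])
  have "?L = (\<Union>u'\<in>word_cong A E `` {u}. \<Union>v'\<in>word_cong A E `` {v}.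
      word_cong A E `` {u' @ v'})"
    by (simp add: presented_def)
  also have "\<dots> = ?R"
    using * word_cong.refl[OF assms(1), of E] word_cong.refl[OF assms(2), of E] by blast
  finally show ?thesis .
qed

lemma presented_carrierE:
  assumes "P \<in> carrier (presented A E)"
  obtains u where "u \<in> lists A" "P = word_cong A E `` {u}"
  using assms unfolding presented_def by (simp, elim quotientE) blast

lemma presented_carrierI: "u \<in> lists A \<Longrightarrow> word_cong A E `` {u} \<in> carrier (presented A E)"
  by (auto simp: presented_def intro: quotientI)

lemma presented_one: "\<one>\<^bsub>presented A E\<^esub> = word_cong A E `` {[]}"
  by (simp add: presented_def)

lemma presented_group:
  assumes inv: "\<And>x. x \<in> A \<Longrightarrow> \<exists>y\<in>A. ([y, x], []) \<in> word_cong A E"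
  shows "group (presented A E)"
proof (rule groupI)
  fix P Q R
  assume "P \<in> carrier (presented A E)" "Q \<in> carrier (presented A E)"
    "R \<in> carrier (presented A E)"
  then show "P \<otimes>\<^bsub>presented A E\<^esub> Q \<otimes>\<^bsub>presented A E\<^esub> R
      = P \<otimes>\<^bsub>presented A E\<^esub> (Q \<otimes>\<^bsub>presented A E\<^esub> R)"
    by (elim presented_carrierE) (simp add: presented_mult)
next
  fix P Q assume "P \<in> carrier (presented A E)" "Q \<in> carrier (presented A E)"
  then show "P \<otimes>\<^bsub>presented A E\<^esub> Q \<in> carrier (presented A E)"
    by (elim presented_carrierE) (simp add: presented_mult presented_carrierI)
next
  show "\<one>\<^bsub>presented A E\<^esub> \<in> carrier (presented A E)"
    by (simp add: presented_one presented_carrierI)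
next
  fix P assume "P \<in> carrier (presented A E)"
  then show "\<one>\<^bsub>presented A E\<^esub> \<otimes>\<^bsub>presented A E\<^esub> P = P"
    by (elim presented_carrierE) (simp add: presented_one presented_mult)
next
  have word_inv: "\<exists>v\<in>lists A. (v @ u, []) \<in> word_cong A E" if "u \<in> lists A" for u
    using that
  proof (induction u)
    case Nil
    have "([] @ [], []) \<in> word_cong A E" by (simp add: word_cong.refl)
    then show ?case by blast
  next
    case (Cons x u)
    then obtain v y where v: "v \<in> lists A" "(v @ u, []) \<in> word_cong A E"
      and y: "y \<in> A" "([y, x], []) \<in> word_cong A E" using inv[of x] by auto
    have "(v @ [y, x] @ u, v @ [] @ u) \<in> word_cong A E"
      using Cons v y by (intro word_cong_context) auto
    then have "((v @ [y]) @ (x # u), []) \<in> word_cong A E"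
      using v word_cong.trans[of "v @ [y, x] @ u" "v @ u"] by simp
    then show ?case using v y by (intro bexI[of _ "v @ [y]"]) auto
  qed
  fix P assume "P \<in> carrier (presented A E)"
  then obtain u where u: "u \<in> lists A" "P = word_cong A E `` {u}"
    by (elim presented_carrierE)
  with word_inv obtain v where v: "v \<in> lists A" "(v @ u, []) \<in> word_cong A E" by blast
  have "word_cong A E `` {v} \<otimes>\<^bsub>presented A E\<^esub> P = \<one>\<^bsub>presented A E\<^esub>"
    using u v by (simp add: presented_mult presented_one equiv_class_eq[OF equiv_word_cong])
  then show "\<exists>Q\<in>carrier (presented A E). Q \<otimes>\<^bsub>presented A E\<^esub> P = \<one>\<^bsub>presented A E\<^esub>"
    using presented_carrierI[OF v(1)] by blast
qed

lemma (in group) word_val_closed: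
  "f \<in> A \<rightarrow> carrier G \<Longrightarrow> u \<in> lists A \<Longrightarrow> word_val G f u \<in> carrier G"
  by (induction u) auto

lemma (in group) word_val_append:
  "f \<in> A \<rightarrow> carrier G \<Longrightarrow> u \<in> lists A \<Longrightarrow> v \<in> lists A
    \<Longrightarrow> word_val G f (u @ v) = word_val G f u \<otimes> word_val G f v"
proof (induction u)
  case (Cons x u)
  then show ?case
    using word_val_closed[of f A u] word_val_closed[of f A v] by (auto simp: m_assoc Pi_iff)
qed (auto dest: word_val_closed)

lemma (in group) lift_class:
  assumes f: "f \<in> A \<rightarrow> carrier G"
    and rel: "\<And>l r. (l, r) \<in> E \<Longrightarrow> l \<in> lists A \<Longrightarrow> r \<in> lists A
      \<Longrightarrow> word_val G f l = word_val G f r"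
    and u: "u \<in> lists A"
  shows "lift G f (word_cong A E `` {u}) = word_val G f u"
proof -
  have val: "word_val G f u = word_val G f v" if "(u, v) \<in> word_cong A E" for u v
    using that
  proof induction
    case (base l r u v)
    have "word_val G f l = word_val G f r" by (rule rel) fact+
    then show ?case using base by (simp add: word_val_append[OF f])
  next
    case (sym u v)
    show ?case by (rule HOL.sym[OF sym.IH])
  next
    case (trans u v w)
    show ?case by (rule HOL.trans[OF trans.IH])
  qed (rule HOL.refl)
  have "word_val G f ` (word_cong A E `` {u}) = {word_val G f u}"
  proof
    show "word_val G f ` (word_cong A E `` {u}) \<subseteq> {word_val G f u}"
      by (auto dest: val[symmetric])
    show "{word_val G f u} \<subseteq> word_val G f ` (word_cong A E `` {u})"
      using word_cong.refl[OF u, of E] by blast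
  qed
  then show ?thesis by (simp add: lift_def)
qed

lemma (in group) lift_hom:
  assumes f: "f \<in> A \<rightarrow> carrier G"
    and rel: "\<And>l r. (l, r) \<in> E \<Longrightarrow> l \<in> lists A \<Longrightarrow> r \<in> lists A
      \<Longrightarrow> word_val G f l = word_val G f r"
  shows "lift G f \<in> hom (presented A E) G"
proof (rule homI)
  fix P assume "P \<in> carrier (presented A E)"
  then show "lift G f P \<in> carrier G"
    by (elim presented_carrierE) (simp add: lift_class[OF f rel] word_val_closed[OF f])
next
  fix P Q assume "P \<in> carrier (presented A E)" "Q \<in> carrier (presented A E)"
  then show "lift G f (P \<otimes>\<^bsub>presented A E\<^esub> Q) = lift G f P \<otimes> lift G f Q"
    by (elim presented_carrierE)
      (simp add: presented_mult lift_class[OF f rel] word_val_append[OF f])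
qed

text \<open>The letter \<open>(x, True)\<close> stands for the generator \<open>x\<close> and \<open>(x, False)\<close> for its inverse.\<close>

definition free_group :: "'x set \<Rightarrow> ('x \<times> bool) list set monoid" where
  "free_group V = presented (V \<times> UNIV) {([(x, b), (x, \<not> b)], []) | x b. x \<in> V}"

definition free_gen :: "'x set \<Rightarrow> 'x \<Rightarrow> ('x \<times> bool) list set" where
  "free_gen V x = word_cong (V \<times> UNIV) {([(x, b), (x, \<not> b)], []) | x b. x \<in> V} `` {[(x, True)]}"

definition free_group_lift ::
    "('b, 'm) monoid_scheme \<Rightarrow> ('x \<Rightarrow> 'b) \<Rightarrow> ('x \<times> bool) list set \<Rightarrow> 'b" where
  "free_group_lift K g = lift K (\<lambda>(x, b). if b then g x else inv\<^bsub>K\<^esub> g x)"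

definition free_product_rels ::
    "('a, 'm) monoid_scheme \<Rightarrow> ('b, 'n) monoid_scheme \<Rightarrow> (('a + 'b) list \<times> ('a + 'b) list) set" where
  "free_product_rels G H =
     {([Inl a, Inl b], [Inl (a \<otimes>\<^bsub>G\<^esub> b)]) | a b. a \<in> carrier G \<and> b \<in> carrier G}
   \<union> {([Inr a, Inr b], [Inr (a \<otimes>\<^bsub>H\<^esub> b)]) | a b. a \<in> carrier H \<and> b \<in> carrier H}
   \<union> {([Inl \<one>\<^bsub>G\<^esub>], []), ([Inr \<one>\<^bsub>H\<^esub>], [])}"

definition free_product ::
    "('a, 'm) monoid_scheme \<Rightarrow> ('b, 'n) monoid_scheme \<Rightarrow> ('a + 'b) list set monoid" where
  "free_product G H = presented (carrier G <+> carrier H) (free_product_rels G H)"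

definition free_product_inl ::
    "('a, 'm) monoid_scheme \<Rightarrow> ('b, 'n) monoid_scheme \<Rightarrow> 'a \<Rightarrow> ('a + 'b) list set" where
  "free_product_inl G H a =
     word_cong (carrier G <+> carrier H) (free_product_rels G H) `` {[Inl a]}"

definition free_product_inr ::
    "('a, 'm) monoid_scheme \<Rightarrow> ('b, 'n) monoid_scheme \<Rightarrow> 'b \<Rightarrow> ('a + 'b) list set" where
  "free_product_inr G H b =
     word_cong (carrier G <+> carrier H) (free_product_rels G H) `` {[Inr b]}"

definition free_product_lift ::
    "('c, 'm) monoid_scheme \<Rightarrow> ('a \<Rightarrow> 'c) \<Rightarrow> ('b \<Rightarrow> 'c) \<Rightarrow> ('a + 'b) list set \<Rightarrow> 'c" where
  "free_product_lift K h k = lift K (case_sum h k)"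

lemma group_free_group: "group (free_group V)"
  unfolding free_group_def
proof (rule presented_group)
  fix p :: "'a \<times> bool" assume p: "p \<in> V \<times> UNIV"
  obtain x b where xb: "p = (x, b)" by (cases p)
  let ?E = "{([(x, b), (x, \<not> b)], []) | x b. x \<in> V}"
  have "([] @ [(x, \<not> b), (x, b)] @ [], [] @ [] @ []) \<in> word_cong (V \<times> UNIV) ?E"
    by (rule word_cong.base) (use p xb in auto)
  then show "\<exists>y\<in>V \<times> UNIV. ([y, p], []) \<in> word_cong (V \<times> UNIV) ?E"
    using p xb by (intro bexI[of _ "(x, \<not> b)"]) auto
qed

lemma group_free_product:
  assumes "group G" "group H"
  shows "group (free_product G H)"
  unfolding free_product_def
proof (rule presented_group)
  interpret G: group G by fact
  interpret H: group H by fact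
  let ?A = "carrier G <+> carrier H" and ?E = "free_product_rels G H"
  have step: "([] @ l @ [], [] @ r @ []) \<in> word_cong ?A ?E"
    if "(l, r) \<in> ?E" "l \<in> lists ?A" "r \<in> lists ?A" for l r
    using that by (intro word_cong.base) auto
  fix p assume "p \<in> ?A"
  then consider (l) a where "p = Inl a" "a \<in> carrier G" | (r) b where "p = Inr b" "b \<in> carrier H"
    by auto
  then show "\<exists>y\<in>?A. ([y, p], []) \<in> word_cong ?A ?E"
  proof cases
    case l
    have "([] @ [Inl (inv\<^bsub>G\<^esub> a), Inl a] @ [], [] @ [Inl (inv\<^bsub>G\<^esub> a \<otimes>\<^bsub>G\<^esub> a)] @ []) \<in> word_cong ?A ?E"
      using l by (intro step) (auto simp: free_product_rels_def simp del: G.l_inv)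
    moreover have "([] @ [Inl \<one>\<^bsub>G\<^esub>] @ [], [] @ [] @ []) \<in> word_cong ?A ?E"
      by (intro step) (auto simp: free_product_rels_def)
    ultimately have "([Inl (inv\<^bsub>G\<^esub> a), p], []) \<in> word_cong ?A ?E"
      using l word_cong.trans[of _ "[Inl \<one>\<^bsub>G\<^esub>]"] by simp
    then show ?thesis using l by (intro bexI[of _ "Inl (inv\<^bsub>G\<^esub> a)"]) auto
  next
    case r
    have "([] @ [Inr (inv\<^bsub>H\<^esub> b), Inr b] @ [], [] @ [Inr (inv\<^bsub>H\<^esub> b \<otimes>\<^bsub>H\<^esub> b)] @ []) \<in> word_cong ?A ?E"
      using r by (intro step) (auto simp: free_product_rels_def simp del: H.l_inv)
    moreover have "([] @ [Inr \<one>\<^bsub>H\<^esub>] @ [], [] @ [] @ []) \<in> word_cong ?A ?E"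
      by (intro step) (auto simp: free_product_rels_def)
    ultimately have "([Inr (inv\<^bsub>H\<^esub> b), p], []) \<in> word_cong ?A ?E"
      using r word_cong.trans[of _ "[Inr \<one>\<^bsub>H\<^esub>]"] by simp
    then show ?thesis using r by (intro bexI[of _ "Inr (inv\<^bsub>H\<^esub> b)"]) auto
  qed
qed

lemma free_group_lift:
  assumes "group K" "g \<in> V \<rightarrow> carrier K"
  shows "free_group_lift K g \<in> hom (free_group V) K"
    and "x \<in> V \<Longrightarrow> free_group_lift K g (free_gen V x) = g x"
proof -
  interpret group K by fact
  let ?f = "\<lambda>(x, b). if b then g x else inv\<^bsub>K\<^esub> g x"
  have f: "?f \<in> V \<times> UNIV \<rightarrow> carrier K" using assms by (auto simp: Pi_iff)
  have rel: "word_val K ?f l = word_val K ?f r"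
    if "(l, r) \<in> {([(x, b), (x, \<not> b)], []) | x b. x \<in> V}" for l r
    using that assms by (auto simp: Pi_iff)
  show "free_group_lift K g \<in> hom (free_group V) K"
    unfolding free_group_lift_def free_group_def by (intro lift_hom f rel)
  show "x \<in> V \<Longrightarrow> free_group_lift K g (free_gen V x) = g x"
    unfolding free_group_lift_def free_gen_def
    using assms by (subst lift_class[OF f rel]) (auto simp: Pi_iff)
qed

lemma free_product_lift:
  assumes "group G" "group H" "group K" "h \<in> hom G K" "k \<in> hom H K"
  shows "free_product_lift K h k \<in> hom (free_product G H) K"
    and "a \<in> carrier G \<Longrightarrow> free_product_lift K h k (free_product_inl G H a) = h a"
    and "b \<in> carrier H \<Longrightarrow> free_product_lift K h k (free_product_inr G H b) = k b"
proof -
  interpret K: group K by fact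
  interpret h: group_hom G K h using assms by (simp add: group_hom_def group_hom_axioms_def)
  interpret k: group_hom H K k using assms by (simp add: group_hom_def group_hom_axioms_def)
  have f: "case_sum h k \<in> carrier G <+> carrier H \<rightarrow> carrier K" by auto
  have rel: "word_val K (case_sum h k) l = word_val K (case_sum h k) r"
    if "(l, r) \<in> free_product_rels G H" for l r
    using that by (auto simp: free_product_rels_def)
  show "free_product_lift K h k \<in> hom (free_product G H) K"
    unfolding free_product_lift_def free_product_def by (intro K.lift_hom f rel)
  show "a \<in> carrier G \<Longrightarrow> free_product_lift K h k (free_product_inl G H a) = h a"
    unfolding free_product_lift_def free_product_inl_def
    by (subst K.lift_class[OF f rel]) auto
  show "b \<in> carrier H \<Longrightarrow> free_product_lift K h k (free_product_inr G H b) = k b"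
    unfolding free_product_lift_def free_product_inr_def
    by (subst K.lift_class[OF f rel]) auto
qed

abbreviation free_group_on :: "nat \<Rightarrow> (nat \<times> bool) list set monoid" where
  "free_group_on r \<equiv> free_group {1..r}"

type_synonym 'a mixed_word = "('a + (nat \<times> bool) list set) list set"

abbreviation mixed_words :: "('a, 'm) monoid_scheme \<Rightarrow> nat \<Rightarrow> 'a mixed_word monoid" where
  "mixed_words G r \<equiv> free_product G (free_group_on r)"

definition mixed_const :: "('a, 'm) monoid_scheme \<Rightarrow> nat \<Rightarrow> 'a \<Rightarrow> 'a mixed_word" where
  "mixed_const G r = free_product_inl G (free_group_on r)"

definition mixed_var :: "('a, 'm) monoid_scheme \<Rightarrow> nat \<Rightarrow> nat \<Rightarrow> 'a mixed_word" where
  "mixed_var G r i = free_product_inr G (free_group_on r) (free_gen {1..r} i)"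

text \<open>The value \<open>w(g 1, \<dots>, g r)\<close>.\<close>

definition mixed_eval :: "('a, 'm) monoid_scheme \<Rightarrow> (nat \<Rightarrow> 'a) \<Rightarrow> 'a mixed_word \<Rightarrow> 'a" where
  "mixed_eval G g = free_product_lift G (\<lambda>a. a) (free_group_lift G g)"

definition mixed_identity :: "('a, 'm) monoid_scheme \<Rightarrow> nat \<Rightarrow> 'a mixed_word \<Rightarrow> bool" where
  "mixed_identity G r w \<longleftrightarrow>
     w \<in> carrier (mixed_words G r) \<and> w \<noteq> \<one>\<^bsub>mixed_words G r\<^esub> \<and>
     (\<forall>g \<in> {1..r} \<rightarrow> carrier G. mixed_eval G g w = \<one>\<^bsub>G\<^esub>)"

text \<open>The product \<open>c 0 \<cdot> x\<^bsub>i 1\<^esub>\<^bsup>e 1\<^esup> \<cdot> c 1 \<cdots> x\<^bsub>i l\<^esub>\<^bsup>e l\<^esup> \<cdot> c l\<close>.\<close>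

primrec mixed_prod :: "('a, 'm) monoid_scheme \<Rightarrow> nat \<Rightarrow> (nat \<Rightarrow> 'a) \<Rightarrow> (nat \<Rightarrow> nat) \<Rightarrow> (nat \<Rightarrow> int)
    \<Rightarrow> nat \<Rightarrow> 'a mixed_word" where
  "mixed_prod G r c i e 0 = mixed_const G r (c 0)"
| "mixed_prod G r c i e (Suc l) =
     mixed_prod G r c i e l
       \<otimes>\<^bsub>mixed_words G r\<^esub> (mixed_var G r (i (Suc l)) [^]\<^bsub>mixed_words G r\<^esub> e (Suc l))
       \<otimes>\<^bsub>mixed_words G r\<^esub> mixed_const G r (c (Suc l))"

definition reduced_form :: "('a, 'm) monoid_scheme \<Rightarrow> nat \<Rightarrow> 'a mixed_word
    \<Rightarrow> (nat \<Rightarrow> 'a) \<Rightarrow> (nat \<Rightarrow> nat) \<Rightarrow> (nat \<Rightarrow> int) \<Rightarrow> nat \<Rightarrow> bool" where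
  "reduced_form G r w c i e l \<longleftrightarrow>
     (\<forall>j\<le>l. c j \<in> carrier G) \<and>
     (\<forall>j\<in>{1..l}. i j \<in> {1..r} \<and> e j \<in> {1, -1}) \<and>
     (\<forall>j. 1 \<le> j \<and> j < l \<longrightarrow> i j = i (j + 1) \<longrightarrow> e j = - e (j + 1) \<longrightarrow> c j \<noteq> \<one>\<^bsub>G\<^esub>) \<and>
     w = mixed_prod G r c i e l"

text \<open>The product \<open>x\<^bsub>i 1\<^esub>\<^bsup>e 1\<^esup> \<cdots> x\<^bsub>i l\<^esub>\<^bsup>e l\<^esup>\<close> in the free group.\<close>

primrec content_prod :: "nat \<Rightarrow> (nat \<Rightarrow> nat) \<Rightarrow> (nat \<Rightarrow> int) \<Rightarrow> nat \<Rightarrow> (nat \<times> bool) list set" where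
  "content_prod r i e 0 = \<one>\<^bsub>free_group_on r\<^esub>"
| "content_prod r i e (Suc l) =
     content_prod r i e l
       \<otimes>\<^bsub>free_group_on r\<^esub> (free_gen {1..r} (i (Suc l)) [^]\<^bsub>free_group_on r\<^esub> e (Suc l))"

text \<open>Length and content are read off from the reduced form, which exists and is unique; they are
  stated as relations so that this uniqueness is not built into the definitions.\<close>

definition has_length :: "('a, 'm) monoid_scheme \<Rightarrow> nat \<Rightarrow> 'a mixed_word \<Rightarrow> nat \<Rightarrow> bool" where
  "has_length G r w l \<longleftrightarrow> (\<exists>c i e. reduced_form G r w c i e l)"

definition has_content ::
    "('a, 'm) monoid_scheme \<Rightarrow> nat \<Rightarrow> 'a mixed_word \<Rightarrow> (nat \<times> bool) list set \<Rightarrow> bool" where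
  "has_content G r w y \<longleftrightarrow> (\<exists>c i e l. reduced_form G r w c i e l \<and> y = content_prod r i e l)"

definition singular :: "('a, 'm) monoid_scheme \<Rightarrow> nat \<Rightarrow> 'a mixed_word \<Rightarrow> bool" where
  "singular G r w \<longleftrightarrow> has_content G r w \<one>\<^bsub>free_group_on r\<^esub>"

definition satisfies_nonsingular_of_length :: "('a, 'm) monoid_scheme \<Rightarrow> nat \<Rightarrow> bool" where
  "satisfies_nonsingular_of_length G l \<longleftrightarrow>
     (\<exists>r\<ge>1. \<exists>w. mixed_identity G r w \<and> \<not> singular G r w \<and> has_length G r w l)"

text \<open>The library's \<^locale>\<open>simple_group\<close> requires \<open>order G > 1\<close>. Since infinite groups have order
  \<open>0\<close> there, it covers finite groups only.\<close>

definition simple_grp :: "('a, 'm) monoid_scheme \<Rightarrow> bool" where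
  "simple_grp G \<longleftrightarrow> group G \<and> carrier G \<noteq> {\<one>\<^bsub>G\<^esub>} \<and>
     (\<forall>N. N \<lhd> G \<longrightarrow> N = carrier G \<or> N = {\<one>\<^bsub>G\<^esub>})"

lemma simple_grp_iff_simple_group:
  assumes "finite (carrier G)"
  shows "simple_grp G \<longleftrightarrow> simple_group G"
proof
  assume "simple_grp G"
  then interpret group G by (simp add: simple_grp_def)
  have "carrier G = {\<one>\<^bsub>G\<^esub>}" if "carrier G = {x}" for x
    using one_closed unfolding that by blast
  then have "order G \<noteq> 1"
    using \<open>simple_grp G\<close> by (auto simp: simple_grp_def order_def card_1_singleton_iff)
  moreover have "order G \<noteq> 0" using assms by (simp add: order_def) blast
  ultimately have "order G > 1" by linarith
  then show "simple_group G"
    using \<open>simple_grp G\<close>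
    by (simp add: simple_grp_def simple_group_def simple_group_axioms_def)
next
  assume "simple_group G"
  then show "simple_grp G"
    using simple_group.simple_not_triv[of G]
    by (auto simp: simple_grp_def simple_group_def simple_group_axioms_def)
qed

definition locally_finite :: "('a, 'm) monoid_scheme \<Rightarrow> bool" where
  "locally_finite G \<longleftrightarrow> (\<forall>S. S \<subseteq> carrier G \<and> finite S \<longrightarrow> finite (generate G S))"

text \<open>Isomorphism classes of finite groups are represented by groups with carrier in \<^typ>\<open>nat\<close>:
  every finite group is isomorphic to such a group.\<close>

definition nonsingular_simple_groups :: "nat \<Rightarrow> nat monoid set" where
  "nonsingular_simple_groups l =
     {H. simple_grp H \<and> finite (carrier H) \<and> \<not> comm_group H \<and> satisfies_nonsingular_of_length H l}"

definition iso_classes :: "'a monoid set \<Rightarrow> 'a monoid set set" where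
  "iso_classes S = S // {(H, K). H \<in> S \<and> K \<in> S \<and> H \<cong> K}"

end

theory Submission
  imports Defs "HOL-Algebra.Weak_Morphisms"
begin

text \<open>By Kegel's argument a finite subset \<open>F\<close> of a locally finite simple group \<open>G\<close> embeds into a
  finite simple section \<open>K/M\<close> of \<open>G\<close>. Take for \<open>F\<close> the coefficients of a nonsingular identity \<open>w\<close>
  of length \<open>l\<close>, a noncommuting pair and arbitrarily many further elements. Reducing the
  coefficients modulo \<open>M\<close> yields a word over \<open>K/M\<close> that is still reduced of length \<open>l\<close>, has the
  same content, and vanishes on \<open>K/M\<close>. So nonabelian finite simple groups of unbounded order
  satisfy nonsingular identities of length \<open>l\<close>.\<close>

text \<open>Frees \<open><+>\<close> for the disjoint sum of carriers, as used in
  \<open>free_product\<close>.\<close>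

no_notation set_add (infixl \<open><+>\<index>\<close> 60)

text \<open>The simplifier would otherwise rewrite \<^term>\<open>free_group_on r\<close> to \<open>free_group {Suc 0..r}\<close>.\<close>

declare One_nat_def [simp del]

section \<open>Alternating products under homomorphisms\<close>

text \<open>The common shape of a mixed word, of its value in a group and, with trivial constants,
  of its content. One homomorphism lemma then covers evaluation, content and reduction of
  coefficients.\<close>

primrec alternating_prod :: "('b, 'm) monoid_scheme \<Rightarrow> (nat \<Rightarrow> 'b) \<Rightarrow> (nat \<Rightarrow> 'b) \<Rightarrow> (nat \<Rightarrow> int)
    \<Rightarrow> nat \<Rightarrow> 'b" where
  "alternating_prod K c y e 0 = c 0"
| "alternating_prod K c y e (Suc l) =
     alternating_prod K c y e l \<otimes>\<^bsub>K\<^esub> (y (Suc l) [^]\<^bsub>K\<^esub> e (Suc l)) \<otimes>\<^bsub>K\<^esub> c (Suc l)"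

lemma (in group) alternating_prod_closed:
  assumes "\<forall>j\<le>l. c j \<in> carrier G" "\<forall>j\<in>{1..l}. y j \<in> carrier G"
  shows "alternating_prod G c y e l \<in> carrier G"
  using assms by (induction l) auto

lemma alternating_prod_cong:
  assumes "\<forall>j\<le>l. c j = c' j" "\<forall>j\<in>{1..l}. y j = y' j \<and> e j = e' j"
  shows "alternating_prod K c y e l = alternating_prod K c' y' e' l"
  using assms by (induction l) auto

lemma (in group_hom) hom_alternating_prod:
  assumes "\<forall>j\<le>l. c j \<in> carrier G" "\<forall>j\<in>{1..l}. y j \<in> carrier G"
  shows "h (alternating_prod G c y e l)
    = alternating_prod H (\<lambda>j. h (c j)) (\<lambda>j. h (y j)) e l"
  using assms
proof (induction l)
  case (Suc l)
  then have "alternating_prod G c y e l \<in> carrier G"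
    by (intro G.alternating_prod_closed) auto
  with Suc show ?case by (auto simp: hom_int_pow)
qed simp

lemma mixed_prod_alternating_prod:
  "mixed_prod G r c i e l = alternating_prod (mixed_words G r)
    (\<lambda>j. mixed_const G r (c j)) (\<lambda>j. mixed_var G r (i j)) e l"
  by (induction l) auto

lemma mixed_prod_cong:
  assumes "\<forall>j\<le>l. c j = c' j" "\<forall>j\<in>{1..l}. i j = i' j \<and> e j = e' j"
  shows "mixed_prod G r c i e l = mixed_prod G r c' i' e' l"
  unfolding mixed_prod_alternating_prod using assms by (intro alternating_prod_cong) auto

section \<open>Free products and free groups: maps from the factors and induction\<close>

lemma presented_class_eqI:
  "(u, v) \<in> word_cong A E \<Longrightarrow> word_cong A E `` {u} = word_cong A E `` {v}"
  by (rule equiv_class_eq[OF equiv_word_cong])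

lemma presented_rel:
  assumes "(l, r) \<in> E" "l \<in> lists A" "r \<in> lists A"
  shows "word_cong A E `` {l} = word_cong A E `` {r}"
  using word_cong.base[OF assms, of "[]" "[]"] by (intro presented_class_eqI) simp

lemma free_product_inl_hom:
  assumes "group G"
  shows "free_product_inl G H \<in> hom G (free_product G H)"
proof -
  interpret group G by fact
  have "word_cong (carrier G <+> carrier H) (free_product_rels G H) `` {[Inl a, Inl b]}
      = word_cong (carrier G <+> carrier H) (free_product_rels G H) `` {[Inl (a \<otimes>\<^bsub>G\<^esub> b)]}"
    if "a \<in> carrier G" "b \<in> carrier G" for a b
    using that by (intro presented_rel) (auto simp: free_product_rels_def)
  then show ?thesis
    by (intro homI) (simp_all add: free_product_def free_product_inl_def presented_mult
        presented_carrierI InlI InrI)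
qed

lemma free_product_inr_hom:
  assumes "group H"
  shows "free_product_inr G H \<in> hom H (free_product G H)"
proof -
  interpret group H by fact
  have "word_cong (carrier G <+> carrier H) (free_product_rels G H) `` {[Inr a, Inr b]}
      = word_cong (carrier G <+> carrier H) (free_product_rels G H) `` {[Inr (a \<otimes>\<^bsub>H\<^esub> b)]}"
    if "a \<in> carrier H" "b \<in> carrier H" for a b
    using that by (intro presented_rel) (auto simp: free_product_rels_def)
  then show ?thesis
    by (intro homI) (simp_all add: free_product_def free_product_inr_def presented_mult
        presented_carrierI InlI InrI)
qed

text \<open>A class is represented by a word, and a word is built by appending letters. Appending on
  the right matches the recursion of \<open>mixed_prod\<close>.\<close>

lemma free_product_induct [consumes 1, case_names one inl inr]:
  assumes w: "w \<in> carrier (free_product G H)"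
    and one: "P \<one>\<^bsub>free_product G H\<^esub>"
    and inl: "\<And>w a. w \<in> carrier (free_product G H) \<Longrightarrow> P w \<Longrightarrow> a \<in> carrier G
      \<Longrightarrow> P (w \<otimes>\<^bsub>free_product G H\<^esub> free_product_inl G H a)"
    and inr: "\<And>w b. w \<in> carrier (free_product G H) \<Longrightarrow> P w \<Longrightarrow> b \<in> carrier H
      \<Longrightarrow> P (w \<otimes>\<^bsub>free_product G H\<^esub> free_product_inr G H b)"
  shows "P w"
proof -
  let ?A = "carrier G <+> carrier H" and ?E = "free_product_rels G H"
  obtain u where u: "u \<in> lists ?A" "w = word_cong ?A ?E `` {u}"
    using w unfolding free_product_def by (rule presented_carrierE)
  have "P (word_cong ?A ?E `` {u})" using u(1)
  proof (induction u rule: rev_induct)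
    case Nil
    then show ?case using one by (simp add: free_product_def presented_one)
  next
    case (snoc x u)
    then have "word_cong ?A ?E `` {u @ [x]}
        = word_cong ?A ?E `` {u} \<otimes>\<^bsub>free_product G H\<^esub> word_cong ?A ?E `` {[x]}"
      by (simp add: free_product_def presented_mult)
    moreover have "word_cong ?A ?E `` {u} \<in> carrier (free_product G H)"
      using snoc by (simp add: free_product_def presented_carrierI)
    ultimately show ?case
      using snoc inl inr by (cases x) (auto simp: free_product_inl_def free_product_inr_def)
  qed
  then show ?thesis using u(2) by simp
qed

lemma free_gen_closed: "x \<in> V \<Longrightarrow> free_gen V x \<in> carrier (free_group V)"
  unfolding free_gen_def free_group_def by (rule presented_carrierI) auto

text \<open>As for free products, but the letter \<open>(x, False)\<close> is rewritten as a power
  with exponent -1, the form in which syllables occur in \<open>mixed_prod\<close>.\<close>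

lemma free_group_induct [consumes 1, case_names one gen]:
  assumes y: "y \<in> carrier (free_group V)"
    and one: "P \<one>\<^bsub>free_group V\<^esub>"
    and gen: "\<And>y x (e :: int). y \<in> carrier (free_group V) \<Longrightarrow> P y \<Longrightarrow> x \<in> V \<Longrightarrow> e \<in> {1, -1}
      \<Longrightarrow> P (y \<otimes>\<^bsub>free_group V\<^esub> (free_gen V x [^]\<^bsub>free_group V\<^esub> e))"
  shows "P y"
proof -
  interpret F: group "free_group V" by (rule group_free_group)
  let ?A = "V \<times> (UNIV :: bool set)" and ?E = "{([(x, b), (x, \<not> b)], []) | x b. x \<in> V}"
  obtain u where u: "u \<in> lists ?A" "y = word_cong ?A ?E `` {u}"
    using y unfolding free_group_def by (rule presented_carrierE)
  have letter: "word_cong ?A ?E `` {[(x, b)]}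
      = free_gen V x [^]\<^bsub>free_group V\<^esub> (if b then 1 else -1 :: int)" if x: "x \<in> V" for x b
  proof (cases b)
    case True
    then show ?thesis using free_gen_closed[OF x] by (simp add: free_gen_def)
  next
    case False
    \<comment> \<open>The defining relation for \<open>b = False\<close> makes the class of
      \<open>(x, False)\<close> a left inverse of the generator.\<close>
    have "word_cong ?A ?E `` {[(x, False), (x, True)]} = word_cong ?A ?E `` {[]}"
      using x by (intro presented_rel) auto
    then have "word_cong ?A ?E `` {[(x, False)]} \<otimes>\<^bsub>free_group V\<^esub> free_gen V x
        = \<one>\<^bsub>free_group V\<^esub>"
      using x by (simp add: free_group_def free_gen_def presented_mult presented_one)
    moreover have "word_cong ?A ?E `` {[(x, False)]} \<in> carrier (free_group V)"
      using x by (simp add: free_group_def presented_carrierI)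
    ultimately have "word_cong ?A ?E `` {[(x, False)]} = inv\<^bsub>free_group V\<^esub> free_gen V x"
      using free_gen_closed[OF x] by (intro F.inv_equality[symmetric])
    also have "\<dots> = free_gen V x [^]\<^bsub>free_group V\<^esub> (- 1 :: int)"
      using F.int_pow_neg[of "free_gen V x" 1, OF free_gen_closed[OF x]]
      unfolding F.int_pow_1[OF free_gen_closed[OF x]] by (rule HOL.sym)
    finally show ?thesis using False by simp
  qed
  have "P (word_cong ?A ?E `` {u})" using u(1)
  proof (induction u rule: rev_induct)
    case Nil
    then show ?case using one by (simp add: free_group_def presented_one)
  next
    case (snoc p u)
    obtain x b where p: "p = (x, b)" "x \<in> V" using snoc.prems by auto
    have "word_cong ?A ?E `` {u @ [p]}
        = word_cong ?A ?E `` {u} \<otimes>\<^bsub>free_group V\<^esub> word_cong ?A ?E `` {[p]}"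
      using snoc.prems by (simp add: free_group_def presented_mult)
    moreover have closed: "word_cong ?A ?E `` {u} \<in> carrier (free_group V)"
      using snoc by (simp add: free_group_def presented_carrierI)
    moreover have P: "P (word_cong ?A ?E `` {u})" using snoc by simp
    ultimately show ?case
      unfolding p(1) letter[OF p(2)] using gen[OF closed P p(2)] by simp
  qed
  then show ?thesis using u(2) by simp
qed

section \<open>Existence of reduced forms\<close>

lemma group_mixed_words: "group G \<Longrightarrow> group (mixed_words G r)"
  by (intro group_free_product group_free_group)

lemma group_hom_mixed_const: "group G \<Longrightarrow> group_hom G (mixed_words G r) (mixed_const G r)"
  unfolding mixed_const_def group_hom_def group_hom_axioms_def
  by (simp add: group_mixed_words free_product_inl_hom)

lemma group_hom_free_product_inr:
  "group G \<Longrightarrow> group_hom (free_group_on r) (mixed_words G r) (free_product_inr G (free_group_on r))"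
  unfolding group_hom_def group_hom_axioms_def
  by (simp add: group_mixed_words free_product_inr_hom group_free_group)

lemma mixed_var_closed:
  assumes "group G" "i \<in> {1..r}"
  shows "mixed_var G r i \<in> carrier (mixed_words G r)"
proof -
  interpret group_hom "free_group_on r" "mixed_words G r" "free_product_inr G (free_group_on r)"
    using assms by (intro group_hom_free_product_inr)
  show ?thesis unfolding mixed_var_def using free_gen_closed[OF assms(2)] by simp
qed

lemma mixed_prod_closed:
  assumes "group G" "\<forall>j\<le>l. c j \<in> carrier G" "\<forall>j\<in>{1..l}. i j \<in> {1..r}"
  shows "mixed_prod G r c i e l \<in> carrier (mixed_words G r)"
proof -
  interpret group_hom G "mixed_words G r" "mixed_const G r"
    using assms by (intro group_hom_mixed_const)
  show ?thesis unfolding mixed_prod_alternating_prod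
    using assms by (intro H.alternating_prod_closed) (auto intro: mixed_var_closed)
qed

text \<open>The factor merges into the last constant \<open>c l\<close>, which is free of the
  cancellation condition because that concerns only indices \<open>j < l\<close>.\<close>

lemma reduced_form_mult_const:
  assumes "group G" and red: "reduced_form G r w c i e l" and a: "a \<in> carrier G"
  shows "reduced_form G r (w \<otimes>\<^bsub>mixed_words G r\<^esub> mixed_const G r a)
    (c(l := c l \<otimes>\<^bsub>G\<^esub> a)) i e l"
proof -
  interpret group_hom G "mixed_words G r" "mixed_const G r"
    using assms by (intro group_hom_mixed_const)
  have c: "\<And>j. j \<le> l \<Longrightarrow> c j \<in> carrier G" and i: "\<And>j. j \<in> {1..l} \<Longrightarrow> i j \<in> {1..r}"
    and w: "w = mixed_prod G r c i e l"
    using red by (auto simp: reduced_form_def)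
  have "w \<otimes>\<^bsub>mixed_words G r\<^esub> mixed_const G r a
      = mixed_prod G r (c(l := c l \<otimes>\<^bsub>G\<^esub> a)) i e l"
  proof (cases l)
    case 0
    then show ?thesis using w c[of 0] a by simp
  next
    case (Suc k)
    have "mixed_prod G r (c(l := c l \<otimes>\<^bsub>G\<^esub> a)) i e k = mixed_prod G r c i e k"
      using Suc by (intro mixed_prod_cong) auto
    moreover have "mixed_prod G r c i e k \<in> carrier (mixed_words G r)"
      using c i Suc assms(1) by (intro mixed_prod_closed) auto
    moreover have "mixed_var G r (i (Suc k)) \<in> carrier (mixed_words G r)"
      using i Suc assms(1) by (intro mixed_var_closed) auto
    ultimately show ?thesis using w c[of l] a Suc by (simp add: H.m_assoc)
  qed
  then show ?thesis using red a unfolding reduced_form_def by auto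
qed

text \<open>The new syllable either cancels the last one, and the form gets shorter, or it is
  appended with trailing constant 1.\<close>

lemma reduced_form_mult_var:
  fixes d :: int
  assumes "group G" and red: "reduced_form G r w c i e l"
    and x: "x \<in> {1..r}" and d: "d \<in> {1, -1}"
  shows "\<exists>c i e l. reduced_form G r
    (w \<otimes>\<^bsub>mixed_words G r\<^esub> (mixed_var G r x [^]\<^bsub>mixed_words G r\<^esub> d)) c i e l"
proof -
  interpret group_hom G "mixed_words G r" "mixed_const G r"
    using assms by (intro group_hom_mixed_const)
  have c: "\<And>j. j \<le> l \<Longrightarrow> c j \<in> carrier G" and i: "\<And>j. j \<in> {1..l} \<Longrightarrow> i j \<in> {1..r}"
    and w: "w = mixed_prod G r c i e l"
    using red by (auto simp: reduced_form_def)
  have v: "mixed_var G r x \<in> carrier (mixed_words G r)"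
    using assms by (intro mixed_var_closed)
  have P: "mixed_prod G r c i e k \<in> carrier (mixed_words G r)" if "k \<le> l" for k
    using c i assms(1) that by (intro mixed_prod_closed) auto
  show ?thesis
  proof (cases "l \<noteq> 0 \<and> c l = \<one>\<^bsub>G\<^esub> \<and> i l = x \<and> e l = - d")
    case True
    then obtain k where k: "l = Suc k" using not0_implies_Suc by blast
    have "mixed_var G r x [^]\<^bsub>mixed_words G r\<^esub> (- d)
        \<otimes>\<^bsub>mixed_words G r\<^esub> (mixed_var G r x [^]\<^bsub>mixed_words G r\<^esub> d)
        = \<one>\<^bsub>mixed_words G r\<^esub>"
      using v by (simp add: H.int_pow_neg)
    then have "w \<otimes>\<^bsub>mixed_words G r\<^esub> (mixed_var G r x [^]\<^bsub>mixed_words G r\<^esub> d)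
        = mixed_prod G r c i e k"
      using True w k P[of k] v by (simp add: H.m_assoc)
    then have "reduced_form G r
        (w \<otimes>\<^bsub>mixed_words G r\<^esub> (mixed_var G r x [^]\<^bsub>mixed_words G r\<^esub> d)) c i e k"
      using red k by (auto simp: reduced_form_def)
    then show ?thesis by blast
  next
    case False
    let ?c = "c(Suc l := \<one>\<^bsub>G\<^esub>)" and ?i = "i(Suc l := x)" and ?e = "e(Suc l := d)"
    have "mixed_prod G r ?c ?i ?e l = w"
      unfolding w by (intro mixed_prod_cong) auto
    then have "w \<otimes>\<^bsub>mixed_words G r\<^esub> (mixed_var G r x [^]\<^bsub>mixed_words G r\<^esub> d)
        = mixed_prod G r ?c ?i ?e (Suc l)"
      using v P[of l] w by simp
    \<comment> \<open>The only new condition is the one at \<open>j = l\<close>, and it fails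
      exactly in the case already treated.\<close>
    moreover have "?c j \<noteq> \<one>\<^bsub>G\<^esub>"
      if j: "1 \<le> j" "j < Suc l" "?i j = ?i (j + 1)" "?e j = - ?e (j + 1)" for j
    proof (cases "j = l")
      case True
      then show ?thesis using False j by auto
    next
      case False
      then show ?thesis using j red by (auto simp: reduced_form_def)
    qed
    ultimately have "reduced_form G r
        (w \<otimes>\<^bsub>mixed_words G r\<^esub> (mixed_var G r x [^]\<^bsub>mixed_words G r\<^esub> d)) ?c ?i ?e (Suc l)"
      using c i red x d unfolding reduced_form_def by (auto simp: le_Suc_eq simp del: mixed_prod.simps)
    then show ?thesis by blast
  qed
qed

text \<open>Having a reduced form is preserved by right multiplication with constants and with
  powers of variables, and such factors build up every element.\<close>

lemma reduced_form_exists: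
  assumes "group G" "w \<in> carrier (mixed_words G r)"
  shows "\<exists>c i e l. reduced_form G r w c i e l"
  using assms(2)
proof (induction rule: free_product_induct)
  case one
  interpret group_hom G "mixed_words G r" "mixed_const G r"
    using assms by (intro group_hom_mixed_const)
  have "reduced_form G r \<one>\<^bsub>mixed_words G r\<^esub> (\<lambda>_. \<one>\<^bsub>G\<^esub>) i e 0" for i e
    by (auto simp: reduced_form_def)
  then show ?case by blast
next
  case (inl w a)
  then show ?case
    using reduced_form_mult_const[OF assms(1)] unfolding mixed_const_def by blast
next
  \<comment> \<open>A single letter \<open>b\<close> of the free product may be a long word in the
    variables, so an inner induction multiplies by one generator power at a time.\<close>
  case (inr w b)
  interpret group_hom "free_group_on r" "mixed_words G r" "free_product_inr G (free_group_on r)"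
    using assms by (intro group_hom_free_product_inr)
  from \<open>b \<in> carrier (free_group_on r)\<close> show ?case
  proof (induction rule: free_group_induct)
    case one
    then show ?case using inr by simp
  next
    case (gen y x e)
    have "w \<otimes>\<^bsub>mixed_words G r\<^esub> free_product_inr G (free_group_on r)
          (y \<otimes>\<^bsub>free_group_on r\<^esub> (free_gen {1..r} x [^]\<^bsub>free_group_on r\<^esub> e))
        = w \<otimes>\<^bsub>mixed_words G r\<^esub> free_product_inr G (free_group_on r) y
          \<otimes>\<^bsub>mixed_words G r\<^esub> (mixed_var G r x [^]\<^bsub>mixed_words G r\<^esub> e)"
      using gen inr free_gen_closed[OF \<open>x \<in> {1..r}\<close>]
      by (simp add: mixed_var_def hom_int_pow H.m_assoc)
    then show ?case using reduced_form_mult_var[OF assms(1) _ \<open>x \<in> {1..r}\<close> \<open>e \<in> {1, -1}\<close>] gen by metis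
  qed
qed

section \<open>Evaluation and content as homomorphisms\<close>

lemma mixed_eval_mixed_prod:
  assumes "group G" "\<forall>j\<le>l. c j \<in> carrier G" "\<forall>j\<in>{1..l}. i j \<in> {1..r}"
    and g: "g \<in> {1..r} \<rightarrow> carrier G"
  shows "mixed_eval G g (mixed_prod G r c i e l) = alternating_prod G c (\<lambda>j. g (i j)) e l"
proof -
  note lift = free_product_lift[OF \<open>group G\<close> group_free_group \<open>group G\<close> _
      free_group_lift(1)[OF \<open>group G\<close> g]]
  have id: "(\<lambda>a. a) \<in> hom G G" by (simp add: hom_def)
  interpret const: group_hom G "mixed_words G r" "mixed_const G r"
    using assms by (intro group_hom_mixed_const)
  interpret ev: group_hom "mixed_words G r" G "mixed_eval G g"
    using lift(1)[OF id] assms(1)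
    by (simp add: group_hom_def group_hom_axioms_def group_mixed_words mixed_eval_def)
  have "mixed_eval G g (mixed_var G r x) = g x" if "x \<in> {1..r}" for x
    using lift(3)[OF id free_gen_closed[OF that]] free_group_lift(2)[OF \<open>group G\<close> g that]
    by (simp add: mixed_eval_def mixed_var_def)
  moreover have "mixed_eval G g (mixed_const G r a) = a" if "a \<in> carrier G" for a
    using lift(2)[OF id that] by (simp add: mixed_eval_def mixed_const_def)
  moreover have "\<forall>j\<in>{1..l}. mixed_var G r (i j) \<in> carrier (mixed_words G r)"
    using assms by (auto intro: mixed_var_closed)
  ultimately show ?thesis
    unfolding mixed_prod_alternating_prod using assms(2,3)
    by (subst ev.hom_alternating_prod) (auto intro!: alternating_prod_cong)
qed

text \<open>The homomorphism that kills the constants and fixes the free factor. Being a function of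
  the group element, it gives all reduced forms of a word the same content.\<close>

definition content :: "nat \<Rightarrow> 'a mixed_word \<Rightarrow> (nat \<times> bool) list set" where
  "content r = free_product_lift (free_group_on r) (\<lambda>_. \<one>\<^bsub>free_group_on r\<^esub>) (\<lambda>y. y)"

lemma group_hom_content:
  assumes "group G"
  shows "group_hom (mixed_words G r) (free_group_on r) (content r)"
proof -
  interpret F: group "free_group_on r" by (rule group_free_group)
  have "(\<lambda>_. \<one>\<^bsub>free_group_on r\<^esub>) \<in> hom G (free_group_on r)"
    "(\<lambda>y. y) \<in> hom (free_group_on r) (free_group_on r)"
    by (auto simp: hom_def)
  then have "content r \<in> hom (mixed_words G r) (free_group_on r)"
    unfolding content_def using assms F.is_group by (intro free_product_lift)
  then show ?thesis
    unfolding group_hom_def group_hom_axioms_def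
    using assms by (simp add: group_mixed_words group_free_group)
qed

lemma content_mixed_prod:
  assumes "group G" "\<forall>j\<le>l. c j \<in> carrier G" "\<forall>j\<in>{1..l}. i j \<in> {1..r}"
  shows "content r (mixed_prod G r c i e l) = content_prod r i e l"
proof -
  interpret F: group "free_group_on r" by (rule group_free_group)
  note lift = free_product_lift[OF \<open>group G\<close> F.is_group F.is_group]
  have triv: "(\<lambda>_. \<one>\<^bsub>free_group_on r\<^esub>) \<in> hom G (free_group_on r)"
    and id: "(\<lambda>y. y) \<in> hom (free_group_on r) (free_group_on r)"
    by (auto simp: hom_def)
  note lift = lift(2,3)[OF triv id, folded content_def]
  interpret const: group_hom G "mixed_words G r" "mixed_const G r"
    using assms by (intro group_hom_mixed_const)
  interpret content: group_hom "mixed_words G r" "free_group_on r" "content r"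
    using assms by (intro group_hom_content)
  have "content r (mixed_var G r x) = free_gen {1..r} x" if "x \<in> {1..r}" for x
    using lift(2)[OF free_gen_closed[OF that]] by (simp add: mixed_var_def)
  moreover have "content r (mixed_const G r a) = \<one>\<^bsub>free_group_on r\<^esub>" if "a \<in> carrier G" for a
    using lift(1)[OF that] by (simp add: mixed_const_def)
  moreover have "\<forall>j\<in>{1..l}. mixed_var G r (i j) \<in> carrier (mixed_words G r)"
    using assms by (auto intro: mixed_var_closed)
  ultimately have "content r (mixed_prod G r c i e l)
      = alternating_prod (free_group_on r) (\<lambda>_. \<one>\<^bsub>free_group_on r\<^esub>)
          (\<lambda>j. free_gen {1..r} (i j)) e l"
    unfolding mixed_prod_alternating_prod using assms(2,3)
    by (subst content.hom_alternating_prod) (auto intro!: alternating_prod_cong)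
  also have "\<dots> = content_prod r i e l"
    using assms(3)
  proof (induction l)
    case (Suc l)
    have "alternating_prod (free_group_on r) (\<lambda>_. \<one>\<^bsub>free_group_on r\<^esub>)
          (\<lambda>j. free_gen {1..r} (i j)) e l \<in> carrier (free_group_on r)"
      using Suc by (intro F.alternating_prod_closed) (auto intro: free_gen_closed)
    with Suc show ?case by (simp add: free_gen_closed)
  qed simp
  finally show ?thesis .
qed

text \<open>Every reduced form of \<open>w\<close> has content \<open>content r w\<close>, and at
  least one exists, so the existential in \<open>singular\<close> becomes an equation.\<close>

lemma singular_iff_content:
  assumes "group G" "w \<in> carrier (mixed_words G r)"
  shows "singular G r w \<longleftrightarrow> content r w = \<one>\<^bsub>free_group_on r\<^esub>"
proof -
  have "content r w = content_prod r i e l" if "reduced_form G r w c i e l" for c i e l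
    using that content_mixed_prod[OF assms(1)] unfolding reduced_form_def by blast
  then show ?thesis
    using reduced_form_exists[OF assms] unfolding singular_def has_content_def by metis
qed

section \<open>Conjugation and normal closures\<close>

text \<open>Used to extract finitely many conjugators from membership in a normal closure.\<close>

lemma generate_finite_subset:
  assumes "y \<in> generate G S"
  shows "\<exists>T. finite T \<and> T \<subseteq> S \<and> y \<in> generate G T"
  using assms
proof induction
  case one
  show ?case by (rule exI[of _ "{}"]) (simp add: generate.one)
next
  case (incl h)
  then show ?case by (intro exI[of _ "{h}"]) (simp add: generate.incl)
next
  case (inv h)
  then show ?case by (intro exI[of _ "{h}"]) (simp add: generate.inv)
next
  case (eng h1 h2)
  then obtain T1 T2 where T: "finite T1" "T1 \<subseteq> S" "h1 \<in> generate G T1"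
    "finite T2" "T2 \<subseteq> S" "h2 \<in> generate G T2" by blast
  have mono: "generate G A \<subseteq> generate G B" if "A \<subseteq> B" for A B
  proof
    fix z assume "z \<in> generate G A"
    then show "z \<in> generate G B"
      using that by induction (auto intro: generate.intros)
  qed
  show ?case
    using T mono[of T1 "T1 \<union> T2"] mono[of T2 "T1 \<union> T2"]
    by (intro exI[of _ "T1 \<union> T2"]) (auto intro: generate.eng)
qed

context group
begin

definition conj_by :: "'a \<Rightarrow> 'a \<Rightarrow> 'a" where
  "conj_by h x = h \<otimes> x \<otimes> inv h"

text \<open>For a subgroup \<open>H\<close> this is the smallest subgroup that contains
  \<open>x\<close> and is normalized by \<open>H\<close>. It is also applied to finite sets
  \<open>H\<close> of conjugators.\<close>

definition conj_closure :: "'a set \<Rightarrow> 'a \<Rightarrow> 'a set" where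
  "conj_closure H x = generate G ((\<lambda>h. conj_by h x) ` H)"

lemma conj_by_closed [simp]: "h \<in> carrier G \<Longrightarrow> x \<in> carrier G \<Longrightarrow> conj_by h x \<in> carrier G"
  by (simp add: conj_by_def)

lemma conj_by_conj_by:
  "g \<in> carrier G \<Longrightarrow> h \<in> carrier G \<Longrightarrow> x \<in> carrier G
    \<Longrightarrow> conj_by g (conj_by h x) = conj_by (g \<otimes> h) x"
  by (simp add: conj_by_def m_assoc inv_mult_group)

lemma conj_by_one [simp]: "x \<in> carrier G \<Longrightarrow> conj_by \<one> x = x"
  by (simp add: conj_by_def)

lemma conj_by_inv_conj_by:
  assumes "h \<in> carrier G" "y \<in> carrier G"
  shows "conj_by (inv h) (conj_by h y) = y" "conj_by h (conj_by (inv h) y) = y"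
  using assms by (simp_all add: conj_by_conj_by)

lemma conj_by_mult:
  assumes "h \<in> carrier G" "x \<in> carrier G" "y \<in> carrier G"
  shows "conj_by h (x \<otimes> y) = conj_by h x \<otimes> conj_by h y"
proof -
  have "inv h \<otimes> (h \<otimes> (y \<otimes> inv h)) = y \<otimes> inv h"
    using assms by (simp flip: m_assoc)
  then show ?thesis using assms by (simp add: conj_by_def m_assoc)
qed

lemma conj_by_inv:
  "h \<in> carrier G \<Longrightarrow> x \<in> carrier G \<Longrightarrow> conj_by h (inv x) = inv (conj_by h x)"
  by (simp add: conj_by_def m_assoc inv_mult_group)

lemma conj_closure_subgroup:
  assumes "H \<subseteq> carrier G" "x \<in> carrier G"
  shows "subgroup (conj_closure H x) G"
  unfolding conj_closure_def using assms by (intro generate_is_subgroup) auto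

lemma conj_closure_least:
  assumes "subgroup M G" "\<And>h. h \<in> H \<Longrightarrow> conj_by h x \<in> M"
  shows "conj_closure H x \<subseteq> M"
  unfolding conj_closure_def using assms by (intro generate_subgroup_incl) auto

lemma conj_closure_self:
  assumes "subgroup H G" "x \<in> carrier G"
  shows "x \<in> conj_closure H x"
proof -
  have "conj_by \<one> x \<in> conj_closure H x"
    unfolding conj_closure_def using subgroup.one_closed[OF assms(1)] by (intro generate.incl) auto
  then show ?thesis using assms by simp
qed

text \<open>Conjugation by \<open>h\<close> respects products and inverses and sends the generator
  for \<open>k\<close> to the generator for \<open>h \<otimes> k\<close>, so induction on generation
  applies.\<close>

lemma conj_by_conj_closure:
  assumes H: "subgroup H G" and x: "x \<in> carrier G" and h: "h \<in> H" and y: "y \<in> conj_closure H x"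
  shows "conj_by h y \<in> conj_closure H x"
proof -
  have Hsub: "H \<subseteq> carrier G" using H by (rule subgroup.subset)
  then have hG: "h \<in> carrier G" using h by blast
  have sub: "subgroup (conj_closure H x) G" using conj_closure_subgroup Hsub x .
  have closed: "z \<in> carrier G" if "z \<in> generate G ((\<lambda>h. conj_by h x) ` H)" for z
    using that sub subgroup.subset unfolding conj_closure_def by blast
  have gen: "conj_by h (conj_by k x) \<in> conj_closure H x" if "k \<in> H" for k
  proof -
    have "conj_by (h \<otimes> k) x \<in> conj_closure H x"
      unfolding conj_closure_def using that subgroup.m_closed[OF H h] by (intro generate.incl) auto
    then show ?thesis using that Hsub hG x by (auto simp: conj_by_conj_by)
  qed
  show ?thesis using y[unfolded conj_closure_def]
  proof induction
    case one
    then show ?case using subgroup.one_closed[OF sub] hG by (simp add: conj_by_def)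
  next
    case (incl y)
    then show ?case using gen by blast
  next
    case (inv y)
    then show ?case using gen subgroup.m_inv_closed[OF sub] Hsub hG x
      by (auto simp: conj_by_inv)
  next
    case (eng y z)
    then show ?case using closed hG subgroup.m_closed[OF sub] by (simp add: conj_by_mult)
  qed
qed

text \<open>Together with the converse below, this expresses normality in a subgroup by conjugation
  in the ambient group; inverses in \<open>K\<close> and in \<open>G\<close> agree.\<close>

lemma normalI_conj_by:
  assumes "subgroup K G" "subgroup M G" "M \<subseteq> K"
    and "\<And>k x. k \<in> K \<Longrightarrow> x \<in> M \<Longrightarrow> conj_by k x \<in> M"
  shows "M \<lhd> G\<lparr>carrier := K\<rparr>"
proof -
  interpret K: group "G\<lparr>carrier := K\<rparr>" using assms(1) by (rule subgroup_imp_group)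
  show ?thesis
    using assms subgroup_incl[OF assms(2,1,3)]
    by (intro K.normal_invI) (auto simp: conj_by_def m_inv_consistent)
qed

lemma normalD_conj_by:
  assumes "subgroup K G" "M \<lhd> G\<lparr>carrier := K\<rparr>"
  shows "subgroup M G" "M \<subseteq> K" "\<And>k x. k \<in> K \<Longrightarrow> x \<in> M \<Longrightarrow> conj_by k x \<in> M"
proof -
  interpret K: group "G\<lparr>carrier := K\<rparr>" using assms(1) by (rule subgroup_imp_group)
  have M: "subgroup M (G\<lparr>carrier := K\<rparr>)" using assms(2) by (rule normal_imp_subgroup)
  then show "subgroup M G" by (rule incl_subgroup[OF assms(1)])
  show "M \<subseteq> K" using subgroup.subset[OF M] by simp
  show "conj_by k x \<in> M" if "k \<in> K" "x \<in> M" for k x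
    using normal.inv_op_closed2[OF assms(2), of k x] that assms(1)
    by (simp add: conj_by_def m_inv_consistent)
qed

text \<open>Conjugation by \<open>g\<close> restricts to an automorphism of \<open>K\<close>, and
  automorphisms preserve normal subgroups.\<close>

lemma conj_by_image_normal:
  assumes K: "subgroup K G" and M: "M \<lhd> G\<lparr>carrier := K\<rparr>"
    and g: "g \<in> carrier G" and norm: "conj_by g ` K = K"
  shows "conj_by g ` M \<lhd> G\<lparr>carrier := K\<rparr>"
proof -
  interpret K: group "G\<lparr>carrier := K\<rparr>" using K by (rule subgroup_imp_group)
  have KG: "K \<subseteq> carrier G" using K by (rule subgroup.subset)
  have "inj_on (conj_by g) K"
    using conj_by_inv_conj_by(1)[OF g] KG by (intro inj_on_inverseI[of _ "conj_by (inv g)"]) auto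
  then have "conj_by g \<in> iso (G\<lparr>carrier := K\<rparr>) (G\<lparr>carrier := K\<rparr>)"
    using norm KG g by (auto simp: iso_def hom_def bij_betw_def conj_by_mult subset_iff)
  then show ?thesis
    using iso_normal_subgroup[OF _ K.is_group K.is_group M] by blast
qed

end

section \<open>Finite covers in a locally finite simple group\<close>

text \<open>By simplicity the normal closure of a nontrivial \<open>x\<close> is the whole group, so
  each \<open>y\<close> in \<open>F\<close> is generated by conjugates of \<open>x\<close> under
  finitely many elements. All these conjugators together with \<open>F\<close> generate a finite
  subgroup.\<close>

lemma (in group) locally_finite_conj_cover:
  assumes simple: "simple_grp G" and lf: "locally_finite G"
    and F: "finite F" "F \<subseteq> carrier G"
  shows "\<exists>H. subgroup H G \<and> finite H \<and> F \<subseteq> H \<and> (\<forall>x\<in>F - {\<one>}. F \<subseteq> conj_closure H x)"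
proof -
  have "\<exists>T. finite T \<and> T \<subseteq> carrier G \<and> y \<in> conj_closure T x"
    if x: "x \<in> F - {\<one>}" and y: "y \<in> F" for x y
  proof -
    have xG: "x \<in> carrier G" and yG: "y \<in> carrier G" using x y F by auto
    have self: "subgroup (carrier G) G" by (rule subgroup_self)
    have "conj_closure (carrier G) x \<lhd> G"
      using normalI_conj_by[OF self conj_closure_subgroup[OF _ xG] _
          conj_by_conj_closure[OF self xG]]
        subgroup.subset[OF conj_closure_subgroup[OF subset_refl xG]] by simp
    moreover have "conj_closure (carrier G) x \<noteq> {\<one>}"
      using conj_closure_self[OF self xG] x by auto
    ultimately have "y \<in> conj_closure (carrier G) x"
      using simple yG unfolding simple_grp_def by blast
    then obtain S where S: "finite S" "S \<subseteq> (\<lambda>h. conj_by h x) ` carrier G" "y \<in> generate G S"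
      unfolding conj_closure_def by (blast dest: generate_finite_subset)
    obtain T where "finite T" "T \<subseteq> carrier G" "S = (\<lambda>h. conj_by h x) ` T"
      using finite_subset_image[OF S(1,2)] by blast
    then show ?thesis using S(3) unfolding conj_closure_def by blast
  qed
  then obtain T where T: "\<And>x y. x \<in> F - {\<one>} \<Longrightarrow> y \<in> F
      \<Longrightarrow> finite (T x y) \<and> T x y \<subseteq> carrier G \<and> y \<in> conj_closure (T x y) x"
    by metis
  define S where "S = F \<union> (\<Union>x\<in>F - {\<one>}. \<Union>y\<in>F. T x y)"
  have S: "S \<subseteq> carrier G" "finite S" using F T unfolding S_def by auto
  have "F \<subseteq> conj_closure (generate G S) x" if x: "x \<in> F - {\<one>}" for x
  proof
    fix y assume y: "y \<in> F"
    have "T x y \<subseteq> generate G S"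
      using x y unfolding S_def by (blast intro: generate.incl)
    then have "conj_closure (T x y) x \<subseteq> conj_closure (generate G S) x"
      unfolding conj_closure_def by (intro mono_generate) auto
    then show "y \<in> conj_closure (generate G S) x" using T x y by blast
  qed
  moreover have "F \<subseteq> generate G S" unfolding S_def by (auto intro: generate.incl)
  ultimately show ?thesis
    using generate_is_subgroup[OF S(1)] lf S unfolding locally_finite_def by blast
qed

section \<open>Maximal normal subgroups and Kegel covers\<close>

definition maximal_normal :: "'a set \<Rightarrow> ('a, 'm) monoid_scheme \<Rightarrow> bool" where
  "maximal_normal M G \<longleftrightarrow> M \<lhd> G \<and> M \<noteq> carrier G \<and>
     (\<forall>N. N \<lhd> G \<longrightarrow> M \<subseteq> N \<longrightarrow> N = M \<or> N = carrier G)"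

lemma (in group) maximal_normal_exists:
  assumes "finite (carrier G)" "carrier G \<noteq> {\<one>}"
  shows "\<exists>M. maximal_normal M G"
proof -
  let ?S = "{N. N \<lhd> G \<and> N \<noteq> carrier G}"
  have "?S \<subseteq> Pow (carrier G)"
    using normal_imp_subgroup subgroup.subset by blast
  then have "finite ?S" using assms(1) by (simp add: finite_subset)
  moreover have "{\<one>} \<in> ?S" using one_is_normal assms(2) by auto
  ultimately obtain M where "M \<in> ?S" "\<forall>N\<in>?S. M \<subseteq> N \<longrightarrow> M = N"
    using finite_has_maximal[of ?S] by blast
  then show ?thesis unfolding maximal_normal_def by blast
qed

text \<open>Correspondence of normal subgroups: the preimage of a normal \<open>N\<close> contains
  \<open>M\<close>, so it is \<open>M\<close> or everything, and \<open>N\<close> is the image of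
  its preimage.\<close>

lemma (in group) maximal_normal_simple_quotient:
  assumes "maximal_normal M G"
  shows "simple_grp (G Mod M)"
proof -
  have M: "M \<lhd> G" and ne: "M \<noteq> carrier G" using assms unfolding maximal_normal_def by auto
  interpret M: normal M G by fact
  interpret Q: group "G Mod M" by (rule M.factorgroup_is_group)
  interpret q: group_hom G "G Mod M" "\<lambda>x. M #> x"
    using M.r_coset_hom_Mod by unfold_locales
  have "N = carrier (G Mod M) \<or> N = {\<one>\<^bsub>G Mod M\<^esub>}" if N: "N \<lhd> G Mod M" for N
  proof -
    have N_subgroup: "subgroup N (G Mod M)" using N by (rule normal_imp_subgroup)
    then have N_sub: "N \<subseteq> (\<lambda>x. M #> x) ` carrier G"
      using subgroup.subset by (force simp: carrier_FactGroup)
    let ?P = "{x \<in> carrier G. M #> x \<in> N}"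
    have "?P \<lhd> G"
    proof (rule normal_invI)
      show "subgroup ?P G"
      proof
        show "x \<otimes> y \<in> ?P" if "x \<in> ?P" "y \<in> ?P" for x y
          using that subgroup.m_closed[OF N_subgroup, of "M #> x" "M #> y"] q.hom_mult[of x y] by simp
        show "\<one> \<in> ?P"
          using subgroup.one_closed[OF N_subgroup] q.hom_one by simp
        show "inv x \<in> ?P" if "x \<in> ?P" for x
          using that subgroup.m_inv_closed[OF N_subgroup, of "M #> x"] q.hom_inv[of x] by simp
      qed auto
      show "g \<otimes> x \<otimes> inv g \<in> ?P" if "g \<in> carrier G" "x \<in> ?P" for g x
        using that normal.inv_op_closed2[OF N, of "M #> g" "M #> x"] q.hom_closed[of g] by auto
    qed
    moreover have "M \<subseteq> ?P"
      using subgroup.one_closed[OF N_subgroup] M.subset M.rcos_const[OF is_group]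
      by auto
    ultimately have "?P = M \<or> ?P = carrier G"
      using assms unfolding maximal_normal_def by blast
    moreover have N_image: "N = (\<lambda>x. M #> x) ` ?P" using N_sub by auto
    moreover have "(\<lambda>x. M #> x) ` M = {M}"
    proof -
      have "(\<lambda>x. M #> x) ` M = (\<lambda>x. M) ` M"
        by (intro image_cong M.rcos_const[OF is_group] HOL.refl)
      then show ?thesis using image_constant[OF M.one_closed] by simp
    qed
    ultimately show ?thesis
      unfolding carrier_FactGroup one_FactGroup by (elim disjE) simp_all
  qed
  moreover have "carrier (G Mod M) \<noteq> {\<one>\<^bsub>G Mod M\<^esub>}"
  proof
    assume *: "carrier (G Mod M) = {\<one>\<^bsub>G Mod M\<^esub>}"
    have "x \<in> M" if x: "x \<in> carrier G" for x
    proof -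
      have "M #> x = M" using * x q.hom_closed[OF x] by simp
      then show ?thesis using coset_join1[OF _ x M.is_subgroup] by blast
    qed
    then show False using ne M.subset by blast
  qed
  ultimately show ?thesis using Q.is_group unfolding simple_grp_def by blast
qed

text \<open>With \<open>F0 \<subseteq> F1 \<subseteq> F2\<close> as in the preceding cover lemma, \<open>K\<close> is the normal closure in \<open>F2\<close> of
  one nontrivial element. A normal subgroup of \<open>K \<supseteq> F1\<close> either contains \<open>F0\<close> or meets it
  trivially, and not all \<open>F2\<close>-conjugates of a maximal normal subgroup can contain \<open>F0\<close>.\<close>

theorem (in group) kegel_cover:
  assumes simple: "simple_grp G" and lf: "locally_finite G"
    and F: "finite F" "F \<subseteq> carrier G"
  shows "\<exists>K M. subgroup K G \<and> finite K \<and> F \<subseteq> K \<and> maximal_normal M (G\<lparr>carrier := K\<rparr>) \<and>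
    F \<inter> M \<subseteq> {\<one>}"
proof -
  obtain x0 where x0: "x0 \<in> carrier G" "x0 \<noteq> \<one>"
    using simple unfolding simple_grp_def by blast
  \<comment> \<open>Adding \<open>x0\<close> provides a nontrivial element even if \<open>F\<close>
    has none.\<close>
  define F0 where "F0 = insert x0 F"
  have F0: "finite F0" "F0 \<subseteq> carrier G" "F \<subseteq> F0" "x0 \<in> F0" using F x0 unfolding F0_def by auto
  obtain F1 where F1: "subgroup F1 G" "finite F1" "F0 \<subseteq> F1"
    and cover1: "\<And>x. x \<in> F0 - {\<one>} \<Longrightarrow> F0 \<subseteq> conj_closure F1 x"
    using locally_finite_conj_cover[OF simple lf F0(1,2)] by blast
  have F1G: "F1 \<subseteq> carrier G" using F1(1) by (rule subgroup.subset)
  obtain F2 where F2: "subgroup F2 G" "finite F2" "F1 \<subseteq> F2"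
    and cover2: "\<And>x. x \<in> F1 - {\<one>} \<Longrightarrow> F1 \<subseteq> conj_closure F2 x"
    using locally_finite_conj_cover[OF simple lf F1(2) F1G] by blast
  have F2G: "F2 \<subseteq> carrier G" using F2(1) by (rule subgroup.subset)
  define K where "K = conj_closure F2 x0"
  have K: "subgroup K G" unfolding K_def using conj_closure_subgroup F2G x0(1) .
  \<comment> \<open>The second cover, applied to \<open>x0\<close>, places \<open>F1\<close> inside
    the closure \<open>K\<close>.\<close>
  have F1K: "F1 \<subseteq> K" unfolding K_def using F1(3) F0(4) x0(2) by (intro cover2) auto
  have "K \<subseteq> F2"
    unfolding K_def
  proof (rule conj_closure_least[OF F2(1)])
    fix h assume "h \<in> F2"
    then show "conj_by h x0 \<in> F2"
      using F2 F1 F0(4) unfolding conj_by_def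
      by (meson subgroup.m_closed subgroup.m_inv_closed subsetD)
  qed
  then have finK: "finite K" using F2(2) by (rule finite_subset)
  let ?K = "G\<lparr>carrier := K\<rparr>"
  interpret K: group ?K using K by (rule subgroup_imp_group)
  have KG: "K \<subseteq> carrier G" using K by (rule subgroup.subset)
  have conjK: "conj_by h ` K = K" if h: "h \<in> F2" for h
  proof
    show "conj_by h ` K \<subseteq> K"
      using conj_by_conj_closure[OF F2(1) x0(1) h] unfolding K_def by blast
    have "conj_by (inv h) y \<in> K" if "y \<in> K" for y
      using conj_by_conj_closure[OF F2(1) x0(1) subgroup.m_inv_closed[OF F2(1) h]] that
      unfolding K_def by blast
    moreover have "y = conj_by h (conj_by (inv h) y)" if "y \<in> K" for y
      using h that F2G KG by (intro conj_by_inv_conj_by(2)[symmetric]) auto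
    ultimately show "K \<subseteq> conj_by h ` K" by blast
  qed
  obtain M where M: "maximal_normal M ?K"
  proof -
    have "carrier ?K \<noteq> {\<one>\<^bsub>?K\<^esub>}" using F1K F1(3) F0(4) x0(2) by auto
    then show ?thesis using K.maximal_normal_exists finK that by auto
  qed
  \<comment> \<open>\<open>F2\<close> normalizes \<open>K\<close>, so its elements permute the
    maximal normal subgroups of \<open>K\<close>; conjugation by \<open>inv h\<close> undoes that by
    \<open>h\<close>.\<close>
  have conjM: "maximal_normal (conj_by h ` M) ?K" if h: "h \<in> F2" for h
  proof -
    have hG: "h \<in> carrier G" and h': "inv h \<in> F2"
      using h F2G subgroup.m_inv_closed[OF F2(1) h] by auto
    have inv_img: "conj_by h ` conj_by (inv h) ` X = X" "conj_by (inv h) ` conj_by h ` X = X"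
      if "X \<subseteq> carrier G" for X
      using that conj_by_inv_conj_by[OF hG] by (auto simp: image_image subset_iff cong: image_cong)
    have M_normal: "M \<lhd> ?K" and M_ne: "M \<noteq> K" using M unfolding maximal_normal_def by auto
    have MG: "M \<subseteq> carrier G" using normalD_conj_by(2)[OF K M_normal] KG by blast
    have "N = conj_by h ` M \<or> N = K" if N: "N \<lhd> ?K" "conj_by h ` M \<subseteq> N" for N
    proof -
      have NG: "N \<subseteq> carrier G" using normalD_conj_by(2)[OF K N(1)] KG by blast
      have "conj_by (inv h) ` N \<lhd> ?K"
        using hG by (intro conj_by_image_normal K N(1) conjK h') auto
      moreover have "M \<subseteq> conj_by (inv h) ` N" using image_mono[OF N(2), of "conj_by (inv h)"] inv_img(2)[OF MG] by simp
      ultimately have "conj_by (inv h) ` N = M \<or> conj_by (inv h) ` N = K"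
        using M unfolding maximal_normal_def by simp
      then have "conj_by h ` conj_by (inv h) ` N = conj_by h ` M
          \<or> conj_by h ` conj_by (inv h) ` N = conj_by h ` K" by (elim disjE) simp_all
      then show ?thesis unfolding inv_img(1)[OF NG] conjK[OF h] .
    qed
    moreover have "conj_by h ` M \<lhd> ?K"
      using hG by (intro conj_by_image_normal K M_normal conjK h)
    moreover have "conj_by h ` M \<noteq> K"
    proof
      assume "conj_by h ` M = K"
      then have "conj_by (inv h) ` conj_by h ` M = K" using conjK[OF h'] by simp
      then show False using M_ne inv_img(2)[OF MG] by simp
    qed
    ultimately show ?thesis unfolding maximal_normal_def by simp
  qed
  \<comment> \<open>Otherwise \<open>x0\<close> lies in every \<open>F2\<close>-conjugate of
    \<open>M\<close>. Then \<open>M\<close> contains every \<open>F2\<close>-conjugate of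
    \<open>x0\<close>, hence all of \<open>K\<close>, although it is proper.\<close>
  have "\<exists>M. maximal_normal M ?K \<and> \<not> F0 \<subseteq> M"
  proof (rule ccontr)
    assume "\<not> ?thesis"
    then have all: "x0 \<in> conj_by h ` M" if "h \<in> F2" for h
      using conjM[OF that] F0(4) by blast
    have MG: "subgroup M G" and MK: "M \<subseteq> K"
      using M normalD_conj_by[OF K] unfolding maximal_normal_def by auto
    have "conj_by h x0 \<in> M" if h: "h \<in> F2" for h
    proof -
      have hG: "h \<in> carrier G" using h F2G by blast
      obtain y where y: "y \<in> M" "x0 = conj_by (inv h) y"
        using all[OF subgroup.m_inv_closed[OF F2(1) h]] by blast
      then show ?thesis using conj_by_inv_conj_by(2)[OF hG] MK KG by auto
    qed
    then have "K \<subseteq> M" unfolding K_def using MG by (intro conj_closure_least)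
    then show False using MK M unfolding maximal_normal_def by auto
  qed
  then obtain M' where M': "maximal_normal M' ?K" "\<not> F0 \<subseteq> M'" by blast
  note M'_normal = normalD_conj_by[OF K, of M']
  have "x = \<one>" if x: "x \<in> F" "x \<in> M'" for x
  proof (rule ccontr)
    assume "x \<noteq> \<one>"
    \<comment> \<open>Since \<open>F1\<close> lies in \<open>K\<close>, it normalizes
      \<open>M'\<close>, so the first cover would push all of \<open>F0\<close> into
      \<open>M'\<close>.\<close>
    then have "F0 \<subseteq> conj_closure F1 x" using x F0(3) by (intro cover1) auto
    also have "\<dots> \<subseteq> M'"
      using M'(1) x(2) F1K M'_normal unfolding maximal_normal_def
      by (intro conj_closure_least) auto
    finally show False using M'(2) by simp
  qed
  then show ?thesis using K finK F1K F1(3) F0(3) M'(1) by blast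
qed

section \<open>Finite simple sections\<close>

lemma simple_grp_iso:
  assumes "simple_grp G" "finite (carrier G)" "group H" "f \<in> iso G H"
  shows "simple_grp H"
proof -
  have "finite (carrier H)"
    using assms(2,4) bij_betw_finite unfolding iso_def by blast
  moreover have "simple_group G" using assms(1) simple_grp_iff_simple_group[OF assms(2)] by simp
  then have "simple_group H" using simple_group.iso_simple[OF _ assms(3,4)] by blast
  ultimately show ?thesis using simple_grp_iff_simple_group[of H] by simp
qed

text \<open>A Kegel cover of \<open>F\<close> and of all \<open>x \<otimes> inv y\<close> with
  \<open>x\<close>, \<open>y\<close> in \<open>F\<close> separates the points of \<open>F\<close>
  modulo \<open>M\<close>. The quotient is recoded over the naturals, where the isomorphism classes
  are represented.\<close>

corollary (in group) finite_simple_section: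
  assumes simple: "simple_grp G" and lf: "locally_finite G"
    and F: "finite F" "F \<subseteq> carrier G"
  shows "\<exists>K (H :: nat monoid) f. subgroup K G \<and> F \<subseteq> K \<and> simple_grp H \<and> finite (carrier H) \<and>
    f \<in> hom (G\<lparr>carrier := K\<rparr>) H \<and> f ` K = carrier H \<and> inj_on f F"
proof -
  define D where "D = (\<lambda>(x, y). x \<otimes> inv y) ` (F \<times> F)"
  have "finite (F \<union> D)" "F \<union> D \<subseteq> carrier G" using F unfolding D_def by auto
  from kegel_cover[OF simple lf this] obtain K M where K: "subgroup K G" "finite K" "F \<subseteq> K"
    and M: "maximal_normal M (G\<lparr>carrier := K\<rparr>)" and triv: "D \<inter> M \<subseteq> {\<one>}"
    by blast
  let ?K = "G\<lparr>carrier := K\<rparr>"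
  interpret K: group ?K using K(1) by (rule subgroup_imp_group)
  have MN: "M \<lhd> ?K" using M unfolding maximal_normal_def by blast
  interpret M: normal M ?K by fact
  have finQ: "finite (carrier (?K Mod M))" using K(2) by (simp add: carrier_FactGroup)
  then obtain code :: "'a set \<Rightarrow> nat" where code: "inj_on code (carrier (?K Mod M))"
    using finite_imp_inj_to_nat_seg by blast
  \<comment> \<open>The projection onto the quotient followed by the coding. Its fibres are the
    cosets of \<open>M\<close>, so \<open>image_group\<close> carries the quotient structure over to
    its image.\<close>
  define f where "f = (\<lambda>x. code (M #>\<^bsub>?K\<^esub> x))"
  have wgm: "weak_group_morphism f M ?K"
  proof (rule weak_group_morphismsI[OF MN])
    fix a b assume ab: "a \<in> carrier ?K" "b \<in> carrier ?K"
    then have "f a = f b \<longleftrightarrow> M #>\<^bsub>?K\<^esub> a = M #>\<^bsub>?K\<^esub> b"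
      unfolding f_def using code by (auto simp: carrier_FactGroup inj_on_def)
    also have "\<dots> \<longleftrightarrow> a \<in> M #>\<^bsub>?K\<^esub> b"
      using K.rcos_self[OF ab(1) M.is_subgroup] K.repr_independence[OF _ ab(2) M.is_subgroup]
      by auto
    also have "\<dots> \<longleftrightarrow> a \<otimes>\<^bsub>?K\<^esub> inv\<^bsub>?K\<^esub> b \<in> M"
      using M.rcos_module[OF K.is_group ab(2,1)] .
    finally show "f a = f b \<longleftrightarrow> a \<otimes>\<^bsub>?K\<^esub> inv\<^bsub>?K\<^esub> b \<in> M" .
  qed
  let ?H = "image_group f ?K"
  have "inj_on f F"
  proof (rule inj_onI)
    fix x y assume xy: "x \<in> F" "y \<in> F" "f x = f y"
    then have "x \<otimes> inv y \<in> M"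
      using weak_group_morphism.inj_mod_subgroup[OF wgm, of x y] K
      by (auto simp: m_inv_consistent)
    then have "x \<otimes> inv y = \<one>" using triv xy unfolding D_def by auto
    then show "x = y" using xy F(2) by (metis inv_equality inv_inv inv_closed subsetD)
  qed
  moreover have "simple_grp ?H"
    using simple_grp_iso[OF K.maximal_normal_simple_quotient[OF M] finQ
        K.image_group_is_group[OF wgm] K.weak_group_morphism_is_iso[OF wgm]] .
  moreover have "carrier ?H = f ` K" by (simp add: image_group_carrier)
  ultimately show ?thesis using K K.weak_group_morphism_is_hom[OF wgm] by (metis finite_imageI)
qed

section \<open>Bounded orders, noncommutativity and transfer of identities\<close>

text \<open>Isomorphic groups have equal order, so finitely many classes allow only finitely many
  orders.\<close>

lemma iso_classes_finite_bounded_card: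
  fixes S :: "'a monoid set"
  assumes "finite (iso_classes S)" "\<And>H. H \<in> S \<Longrightarrow> group H"
  shows "\<exists>n. \<forall>H\<in>S. card (carrier H) \<le> n"
proof -
  define R where "R = {(H, K). H \<in> S \<and> K \<in> S \<and> H \<cong> K}"
  have "\<exists>n. \<forall>H\<in>C. card (carrier H) = n" if C: "C \<in> iso_classes S" for C
  proof -
    obtain H where "C = R `` {H}"
      using C unfolding iso_classes_def R_def[symmetric] by (blast elim: quotientE)
    then have "card (carrier K) = card (carrier H)" if "K \<in> C" for K
      using that iso_same_card unfolding R_def by fastforce
    then show ?thesis by blast
  qed
  then obtain n where n: "\<And>C H. C \<in> iso_classes S \<Longrightarrow> H \<in> C \<Longrightarrow> card (carrier H) = n C"
    by metis
  have "card (carrier H) \<le> Max (n ` iso_classes S)" if H: "H \<in> S" for H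
  proof -
    have "R `` {H} \<in> iso_classes S"
      unfolding iso_classes_def R_def[symmetric] using H by (rule quotientI)
    moreover have "H \<in> R `` {H}" using H iso_set_refl unfolding R_def is_iso_def by blast
    ultimately have "card (carrier H) \<in> n ` iso_classes S" using n by blast
    then show ?thesis using assms(1) by simp
  qed
  then show ?thesis by blast
qed

text \<open>In an abelian simple group any nontrivial element generates everything, and local
  finiteness would make the group finite.\<close>

lemma infinite_simple_locally_finite_not_comm:
  assumes simple: "simple_grp G" and inf: "infinite (carrier G)" and lf: "locally_finite G"
  shows "\<exists>a\<in>carrier G. \<exists>b\<in>carrier G. a \<otimes>\<^bsub>G\<^esub> b \<noteq> b \<otimes>\<^bsub>G\<^esub> a"
proof (rule ccontr)
  assume *: "\<not> ?thesis"
  interpret group G using simple by (simp add: simple_grp_def)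
  interpret comm_group G using * by (intro group_comm_groupI) blast
  obtain x where x: "x \<in> carrier G" "x \<noteq> \<one>\<^bsub>G\<^esub>"
    using simple unfolding simple_grp_def by blast
  have "generate G {x} \<lhd> G" using x by (intro subgroup_imp_normal generate_is_subgroup) simp
  moreover have "x \<in> generate G {x}" by (simp add: generate.incl)
  ultimately have "generate G {x} = carrier G"
    using simple x(2) unfolding simple_grp_def by blast
  moreover have "finite (generate G {x})" using lf x unfolding locally_finite_def by simp
  ultimately show False using inf by simp
qed

text \<open>The content map kills the coefficients, so replacing them by their images does not change the
  content; a nontrivial content makes the new word both nontrivial and nonsingular.\<close>

lemma nonsingular_identity_section:
  assumes "group G" and K: "subgroup K G" and "group H"
    and f: "f \<in> hom (G\<lparr>carrier := K\<rparr>) H" and surj: "f ` K = carrier H"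
    and red: "reduced_form G r w c i e l" and cK: "\<forall>j\<le>l. c j \<in> K"
    and nontriv: "\<forall>j\<le>l. c j \<noteq> \<one>\<^bsub>G\<^esub> \<longrightarrow> f (c j) \<noteq> \<one>\<^bsub>H\<^esub>"
    and identity: "mixed_identity G r w" and nonsing: "\<not> singular G r w"
  shows "\<exists>v. mixed_identity H r v \<and> \<not> singular H r v \<and> has_length H r v l"
proof -
  interpret G: group G by fact
  interpret H: group H by fact
  let ?K = "G\<lparr>carrier := K\<rparr>"
  interpret f: group_hom ?K H f
    using f G.subgroup_imp_group[OF K] \<open>group H\<close>
    by (simp add: group_hom_def group_hom_axioms_def)
  \<comment> \<open>The inclusion shows that an alternating product over \<open>K\<close> has the
    same value when formed in \<open>G\<close>.\<close>
  interpret incl: group_hom ?K G "\<lambda>x. x"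
    using G.subgroup_imp_group[OF K] \<open>group G\<close> subgroup.subset[OF K]
    by (auto simp: group_hom_def group_hom_axioms_def hom_def)
  have c: "\<forall>j\<le>l. c j \<in> carrier G" and i: "\<forall>j\<in>{1..l}. i j \<in> {1..r}"
    and w: "w = mixed_prod G r c i e l"
    using red unfolding reduced_form_def by blast+
  have fc: "\<forall>j\<le>l. f (c j) \<in> carrier H" using cK surj by blast
  define v where "v = mixed_prod H r (\<lambda>j. f (c j)) i e l"
  \<comment> \<open>Nontrivial coefficients stay nontrivial, so the condition against cancellation
    survives with the same variables and exponents.\<close>
  have red_v: "reduced_form H r v (\<lambda>j. f (c j)) i e l"
    using red fc nontriv unfolding reduced_form_def v_def by auto
  have v: "v \<in> carrier (mixed_words H r)"
    unfolding v_def using \<open>group H\<close> fc i by (rule mixed_prod_closed)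
  have "w \<in> carrier (mixed_words G r)" using identity unfolding mixed_identity_def by blast
  then have "content r w \<noteq> \<one>\<^bsub>free_group_on r\<^esub>"
    using nonsing singular_iff_content[OF \<open>group G\<close>] by blast
  then have content: "content r v \<noteq> \<one>\<^bsub>free_group_on r\<^esub>"
    unfolding w v_def content_mixed_prod[OF \<open>group G\<close> c i] content_mixed_prod[OF \<open>group H\<close> fc i] .
  have "v \<noteq> \<one>\<^bsub>mixed_words H r\<^esub>"
    using content group_hom.hom_one[OF group_hom_content[OF \<open>group H\<close>]] by metis
  moreover have "mixed_eval H g v = \<one>\<^bsub>H\<^esub>" if g: "g \<in> {1..r} \<rightarrow> carrier H" for g
  proof -
    \<comment> \<open>A tuple in \<open>H\<close> lifts along the surjection to a tuple in
      \<open>K\<close>, at which \<open>w\<close> vanishes; applying \<open>f\<close> to that value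
      yields the value of \<open>v\<close>.\<close>
    have "\<forall>x\<in>{1..r}. \<exists>y\<in>K. f y = g x" using g surj by (metis PiE imageE)
    then obtain g' where g': "\<And>x. x \<in> {1..r} \<Longrightarrow> g' x \<in> K \<and> f (g' x) = g x" by metis
    have g'_Pi: "g' \<in> {1..r} \<rightarrow> carrier G" using g' subgroup.subset[OF K] by auto
    have cK': "\<forall>j\<le>l. c j \<in> carrier ?K" and gK: "\<forall>j\<in>{1..l}. g' (i j) \<in> carrier ?K"
      using cK g' i by auto
    have "mixed_eval H g v = alternating_prod H (\<lambda>j. f (c j)) (\<lambda>j. g (i j)) e l"
      unfolding v_def using mixed_eval_mixed_prod[OF \<open>group H\<close> fc i g] .
    also have "\<dots> = alternating_prod H (\<lambda>j. f (c j)) (\<lambda>j. f (g' (i j))) e l"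
      using g' i by (intro alternating_prod_cong) auto
    also have "\<dots> = f (alternating_prod ?K c (\<lambda>j. g' (i j)) e l)"
      using f.hom_alternating_prod[OF cK' gK] by simp
    also have "alternating_prod ?K c (\<lambda>j. g' (i j)) e l
        = alternating_prod G c (\<lambda>j. g' (i j)) e l"
      using incl.hom_alternating_prod[OF cK' gK] by simp
    also have "\<dots> = mixed_eval G g' w"
      unfolding w using mixed_eval_mixed_prod[OF \<open>group G\<close> c i g'_Pi] by simp
    also have "\<dots> = \<one>\<^bsub>G\<^esub>" using identity g'_Pi unfolding mixed_identity_def by blast
    finally show ?thesis using f.hom_one by simp
  qed
  ultimately have "mixed_identity H r v" using v unfolding mixed_identity_def by blast
  moreover have "\<not> singular H r v" using content singular_iff_content[OF \<open>group H\<close> v] by blast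
  ultimately show ?thesis using red_v unfolding has_length_def by blast
qed

section \<open>Contradiction from sections of unbounded order\<close>

theorem corollary5p12:
  fixes G :: "('a, 'm) monoid_scheme" and r :: nat and w :: "'a mixed_word"
  assumes finitely_many: "\<And>l :: nat. finite (iso_classes (nonsingular_simple_groups l))"
    and simple: "simple_grp G" and inf: "infinite (carrier G)" and lf: "locally_finite G"
    and r: "r \<ge> 1" and identity: "mixed_identity G r w"
  shows "singular G r w"
proof (rule ccontr)
  assume nonsing: "\<not> singular G r w"
  interpret group G using simple by (simp add: simple_grp_def)
  obtain c i e l where red: "reduced_form G r w c i e l"
    using identity reduced_form_exists[OF is_group] unfolding mixed_identity_def by blast
  have "group H" if "H \<in> nonsingular_simple_groups l" for H
    using that by (simp add: nonsingular_simple_groups_def simple_grp_def)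
  then obtain n where n: "\<And>H. H \<in> nonsingular_simple_groups l \<Longrightarrow> card (carrier H) \<le> n"
    using iso_classes_finite_bounded_card[OF finitely_many[of l]] by blast
  obtain a b where ab: "a \<in> carrier G" "b \<in> carrier G" "a \<otimes>\<^bsub>G\<^esub> b \<noteq> b \<otimes>\<^bsub>G\<^esub> a"
    using infinite_simple_locally_finite_not_comm[OF simple inf lf] by blast
  \<comment> \<open>One element more than the bound \<open>n\<close> allows.\<close>
  obtain B where B: "B \<subseteq> carrier G" "finite B" "card B = Suc n"
    using infinite_arbitrarily_large[OF inf] by blast
  \<comment> \<open>\<open>B\<close> forces a large order, the coefficients keep the word reduced,
    and the two products keep the images of \<open>a\<close> and \<open>b\<close> from commuting.
    With the neutral element included, injectivity on \<open>F\<close> keeps nontrivial elements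
    nontrivial.\<close>
  define F where "F = B \<union> c ` {..l} \<union> {\<one>\<^bsub>G\<^esub>, a, b, a \<otimes>\<^bsub>G\<^esub> b, b \<otimes>\<^bsub>G\<^esub> a}"
  have "finite F" "F \<subseteq> carrier G"
    using B ab red unfolding F_def reduced_form_def by auto
  from finite_simple_section[OF simple lf this]
  obtain K and H :: "nat monoid" and f where K: "subgroup K G" "F \<subseteq> K"
    and H: "simple_grp H" "finite (carrier H)"
    and f: "f \<in> hom (G\<lparr>carrier := K\<rparr>) H" "f ` K = carrier H" "inj_on f F"
    by blast
  have grpH: "group H" using H(1) by (simp add: simple_grp_def)
  interpret f: group_hom "G\<lparr>carrier := K\<rparr>" H f
    using f(1) subgroup_imp_group[OF K(1)] grpH by (simp add: group_hom_def group_hom_axioms_def)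
  have "f x \<noteq> \<one>\<^bsub>H\<^esub>" if "x \<in> F" "x \<noteq> \<one>\<^bsub>G\<^esub>" for x
    using that inj_onD[OF f(3), of x "\<one>\<^bsub>G\<^esub>"] f.hom_one unfolding F_def by auto
  moreover have "\<forall>j\<le>l. c j \<in> F" unfolding F_def by auto
  ultimately have "\<exists>v. mixed_identity H r v \<and> \<not> singular H r v \<and> has_length H r v l"
    using nonsingular_identity_section[OF is_group K(1) grpH f(1,2) red _ _ identity nonsing] K(2)
    by blast
  then have "satisfies_nonsingular_of_length H l"
    using r unfolding satisfies_nonsingular_of_length_def by blast
  moreover have "\<not> comm_group H"
  proof
    assume "comm_group H"
    then interpret C: comm_group H .
    have "a \<in> K" "b \<in> K" using K(2) unfolding F_def by auto
    then have "f (a \<otimes>\<^bsub>G\<^esub> b) = f (b \<otimes>\<^bsub>G\<^esub> a)"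
      using f.hom_mult[of a b] f.hom_mult[of b a] f.hom_closed[of a] f.hom_closed[of b] C.m_comm
      by simp
    then show False using inj_onD[OF f(3)] ab(3) unfolding F_def by blast
  qed
  ultimately have "card (carrier H) \<le> n"
    using H by (intro n) (simp add: nonsingular_simple_groups_def)
  \<comment> \<open>Injectivity of \<open>f\<close> on \<open>B\<close> gives \<open>H\<close> more
    than \<open>n\<close> elements.\<close>
  moreover have "card B \<le> card (carrier H)"
    using f(2) K(2) H(2) inj_on_subset[OF f(3)] unfolding F_def
    by (intro card_inj_on_le[of f]) auto
  ultimately show False using B(3) by simp
qed

end
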